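(* Let $n,m$ be two positive integers and $p$ be a prime. Then there is an orbit equivalence from the $n$-dimensional $p$-adic adding machine to the $m$-dimensional $p$-adic adding machine which is $\left(\varpi^{(k)}_{m/n,\epsilon},\varpi^{(k)}_{n/m,\epsilon}\right)$-integrable for every real number $\epsilon>0$ and every integer $k\geqslant 1$ (one and the same orbit equivalence for all $\epsilon$ and $k$).
   Context: **Functions.** $\log^{(1)}(t)=\log t$, $\log^{(j+1)}(t)=\log(\log^{(j)}(t))$ for $t$ sufficiently large, and $\Lambda_k(t)=\prod_{j=1}^k\log^{(j)}(t)$. For real $\alpha>0$, $\epsilon>0$ and an integer $k\geqslant 1$, fix $T=T_{\alpha,k,\epsilon}>0$ with $\log^{(k)}(T)$ defined and positive such that $t\mapsto (t^\alpha/\Lambda_k(t))\cdot(\log^{(k)}t)^{-\epsilon}$ is continuous, positive and increasing on $[T,+\infty)$ (such $T$ exists). Define $\varpi^{(k)}_{\alpha,\epsilon}:\mathbb{R}_{\geqslant 0}\to\mathbb{R}$ to be equal to $(t^\alpha/\Lambda_k(t))\cdot(\log^{(k)}t)^{-\epsilon}$ for $t\geqslant T$, and equal to the constant $(T^\alpha/\Lambda_k(T))\cdot(\log^{(k)}T)^{-\epsilon}$ for $0\leqslant t<T$. **Adding machines.** $\mathbb{Z}_p$ is the ring of $p$-adic integers with its Haar probability measure $\mu_p$; $\mu_p^d$ is the product measure on $\mathbb{Z}_p^d$. The $d$-dimensional $p$-adic adding machine is the action $\mathbb{Z}^d\curvearrowright(\mathbb{Z}_p^d,\mu_p^d)$ by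 addition, $(\mathbf{n},\mathbf{z})\mapsto\mathbf{n}+\mathbf{z}$; it is free and $\mu_p^d$-preserving. **Orbit equivalence.** An orbit equivalence from a free probability measure-preserving action $G\curvearrowright(X,\mu)$ to another one $H\curvearrowright(Y,\nu)$ is a measure isomorphism $\Phi:X\to Y$ with $\Phi(Gx)=H\Phi(x)$ for $\mu$-a.e. $x\in X$. Its cocycle $\kappa^\Phi:G\times X\to H$ is determined (for a.e. $x$) by $\Phi(gx)=\kappa^\Phi(g,x)\Phi(x)$ for all $g\in G$. For $\omega:\mathbb{R}_{\geqslant 0}\to\mathbb{R}_{\geqslant 0}$ non-decreasing, $G,H$ finitely generated, and $|\cdot|_H$ a word length on $H$ (for $\mathbb{Z}^d$: the sum of absolute values of coordinates), $\Phi$ is $\omega$-integrable if for every $g\in G$ there is $c_g>0$ with $\int_X\omega(|\kappa^\Phi(g,x)|_H/c_g)\,\mathrm{d}\mu(x)<\infty$. $\Phi$ is $(\omega_1,\omega_2)$-integrable if $\Phi$ is $\omega_1$-integrable and $\Phi^{-1}$ is $\omega_2$-integrable. *)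

theory Defs
  imports
    "HOL-Probability.Probability"
    "HOL-Algebra.Group_Action"
    "HOL-Algebra.Product_Groups"
    "HOL-Computational_Algebra.Primes"
begin

section \<open>The functions \<open>\<varpi>\<close>\<close>

abbreviation iter_ln :: "nat \<Rightarrow> real \<Rightarrow> real" where
  "iter_ln j \<equiv> ln ^^ j"

definition Lambda :: "nat \<Rightarrow> real \<Rightarrow> real" where
  "Lambda k t = (\<Prod>j=1..k. iter_ln j t)"

definition varpi_formula :: "real \<Rightarrow> nat \<Rightarrow> real \<Rightarrow> real \<Rightarrow> real" where
  "varpi_formula \<alpha> k \<epsilon> t = (t powr \<alpha> / Lambda k t) * iter_ln k t powr (- \<epsilon>)"

text \<open>Since \<^const>\<open>ln\<close> is total in HOL, definedness of the \<open>k\<close>-fold iterated logarithm at \<open>T\<close>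
  has to be required explicitly: all the lower iterates, including \<open>T\<close> itself, are positive.\<close>

definition varpi_threshold :: "real \<Rightarrow> nat \<Rightarrow> real \<Rightarrow> real \<Rightarrow> bool" where
  "varpi_threshold \<alpha> k \<epsilon> T \<longleftrightarrow>
     (\<forall>j\<le>k. iter_ln j T > 0) \<and>
     continuous_on {T..} (varpi_formula \<alpha> k \<epsilon>) \<and>
     (\<forall>t\<ge>T. varpi_formula \<alpha> k \<epsilon> t > 0) \<and>
     mono_on {T..} (varpi_formula \<alpha> k \<epsilon>)"

text \<open>Here \<open>T \<alpha> k \<epsilon>\<close> is the chosen threshold; only arguments \<open>t \<ge> 0\<close> are relevant.\<close>

definition varpi ::
    "(real \<Rightarrow> nat \<Rightarrow> real \<Rightarrow> real) \<Rightarrow> nat \<Rightarrow> real \<Rightarrow> real \<Rightarrow> real \<Rightarrow> real" where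
  "varpi T k \<alpha> \<epsilon> t =
     (if t \<ge> T \<alpha> k \<epsilon> then varpi_formula \<alpha> k \<epsilon> t else varpi_formula \<alpha> k \<epsilon> (T \<alpha> k \<epsilon>))"

section \<open>The \<open>p\<close>-adic integers\<close>

text \<open>The inverse limit of the groups of residues modulo \<open>p ^ k\<close>: the value \<open>x k\<close> is the
  canonical representative of \<open>x\<close> modulo \<open>p ^ k\<close>.\<close>

definition padic_ints :: "nat \<Rightarrow> (nat \<Rightarrow> nat) set" where
  "padic_ints p = {x. \<forall>k. x k < p ^ k \<and> x (Suc k) mod p ^ k = x k}"

definition padic_add :: "nat \<Rightarrow> (nat \<Rightarrow> nat) \<Rightarrow> (nat \<Rightarrow> nat) \<Rightarrow> nat \<Rightarrow> nat" where
  "padic_add p x y = (\<lambda>k. (x k + y k) mod p ^ k)"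

definition padic_of_int :: "nat \<Rightarrow> int \<Rightarrow> nat \<Rightarrow> nat" where
  "padic_of_int p a = (\<lambda>k. nat (a mod int p ^ k))"

text \<open>The topology on \<open>nat \<Rightarrow> nat\<close> is the product of the discrete topologies; its subspace
  topology on the \<open>p\<close>-adic integers is the usual (profinite) one.\<close>

definition padic_haar_measure :: "nat \<Rightarrow> (nat \<Rightarrow> nat) measure \<Rightarrow> bool" where
  "padic_haar_measure p \<mu> \<longleftrightarrow>
     sets \<mu> = sets (restrict_space borel (padic_ints p)) \<and>
     prob_space \<mu> \<and>
     (\<forall>z\<in>padic_ints p. distr \<mu> \<mu> (padic_add p z) = \<mu>)"

definition padic_haar :: "nat \<Rightarrow> (nat \<Rightarrow> nat) measure" where
  "padic_haar p = (THE \<mu>. padic_haar_measure p \<mu>)"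

section \<open>Measure isomorphisms and orbit equivalences\<close>

locale free_pmp_action = group_action G "space M" \<phi> + prob_space M
  for G (structure) and M and \<phi> +
  assumes action_measurable: "g \<in> carrier G \<Longrightarrow> \<phi> g \<in> measurable M M"
    and measure_preserving: "g \<in> carrier G \<Longrightarrow> distr M M (\<phi> g) = M"
    and free: "AE x in M. \<forall>g\<in>carrier G. \<phi> g x = x \<longrightarrow> g = \<one>"

definition ae_inverse :: "'x measure \<Rightarrow> 'y measure \<Rightarrow> ('x \<Rightarrow> 'y) \<Rightarrow> ('y \<Rightarrow> 'x) \<Rightarrow> bool" where
  "ae_inverse M N \<Phi> \<Psi> \<longleftrightarrow> \<Psi> \<in> measurable N M \<and>
     (AE x in M. \<Psi> (\<Phi> x) = x) \<and> (AE y in N. \<Phi> (\<Psi> y) = y)"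

text \<open>As usual in ergodic theory, invertibility is modulo null sets.\<close>

definition measure_isomorphism :: "'x measure \<Rightarrow> 'y measure \<Rightarrow> ('x \<Rightarrow> 'y) \<Rightarrow> bool" where
  "measure_isomorphism M N \<Phi> \<longleftrightarrow>
     \<Phi> \<in> measurable M N \<and> distr M N \<Phi> = N \<and> (\<exists>\<Psi>. ae_inverse M N \<Phi> \<Psi>)"

definition orbit_equivalence where
  "orbit_equivalence G M \<phi> H N \<psi> \<Phi> \<longleftrightarrow>
     free_pmp_action G M \<phi> \<and> free_pmp_action H N \<psi> \<and>
     measure_isomorphism M N \<Phi> \<and>
     (AE x in M. \<Phi> ` orbit G \<phi> x = orbit H \<psi> (\<Phi> x))"

definition cocycle ::
    "('g \<Rightarrow> 'x \<Rightarrow> 'x) \<Rightarrow> ('h, 'c) monoid_scheme \<Rightarrow> ('h \<Rightarrow> 'y \<Rightarrow> 'y) \<Rightarrow> ('x \<Rightarrow> 'y) \<Rightarrow> 'g \<Rightarrow> 'x \<Rightarrow> 'h" where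
  "cocycle \<phi> H \<psi> \<Phi> g x = (THE h. h \<in> carrier H \<and> \<Phi> (\<phi> g x) = \<psi> h (\<Phi> x))"

text \<open>\<open>len\<close> is the word length on \<open>H\<close>.\<close>

definition omega_integrable where
  "omega_integrable \<omega> G M \<phi> H \<psi> (len :: 'h \<Rightarrow> nat) \<Phi> \<longleftrightarrow>
     (\<forall>g\<in>carrier G. \<exists>c>0::real.
        (\<integral>\<^sup>+ x. ennreal (\<omega> (real (len (cocycle \<phi> H \<psi> \<Phi> g x)) / c)) \<partial>M) < \<infinity>)"

text \<open>The a.e. inverse is unique up to null sets, and hence so is its cocycle.\<close>

definition omega_pair_integrable where
  "omega_pair_integrable \<omega>\<^sub>1 \<omega>\<^sub>2 G M \<phi> len\<^sub>G H N \<psi> len\<^sub>H \<Phi> \<longleftrightarrow>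
     omega_integrable \<omega>\<^sub>1 G M \<phi> H \<psi> len\<^sub>H \<Phi> \<and>
     (\<exists>\<Psi>. ae_inverse M N \<Phi> \<Psi> \<and> omega_integrable \<omega>\<^sub>2 H N \<psi> G \<phi> len\<^sub>G \<Psi>)"

section \<open>Adding machines\<close>

abbreviation Zpow :: "nat \<Rightarrow> (nat \<Rightarrow> int) monoid" where
  "Zpow d \<equiv> product_group {..<d} (\<lambda>_. integer_group)"

definition l1_length :: "nat \<Rightarrow> (nat \<Rightarrow> int) \<Rightarrow> nat" where
  "l1_length d g = (\<Sum>i<d. nat \<bar>g i\<bar>)"

definition padic_space :: "nat \<Rightarrow> nat \<Rightarrow> (nat \<Rightarrow> nat \<Rightarrow> nat) measure" where
  "padic_space p d = Pi\<^sub>M {..<d} (\<lambda>_. padic_haar p)"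

definition adding_machine ::
    "nat \<Rightarrow> nat \<Rightarrow> (nat \<Rightarrow> int) \<Rightarrow> (nat \<Rightarrow> nat \<Rightarrow> nat) \<Rightarrow> (nat \<Rightarrow> nat \<Rightarrow> nat)" where
  "adding_machine p d g =
     (\<lambda>z\<in>space (padic_space p d). \<lambda>i\<in>{..<d}. padic_add p (padic_of_int p (g i)) (z i))"

section \<open>Well-definedness\<close>

lemma varpi_pos: "varpi_threshold \<alpha> k \<epsilon> (T \<alpha> k \<epsilon>) \<Longrightarrow> varpi T k \<alpha> \<epsilon> t > 0"
  by (auto simp: varpi_def varpi_threshold_def)

lemma mono_varpi: "varpi_threshold \<alpha> k \<epsilon> (T \<alpha> k \<epsilon>) \<Longrightarrow> mono (varpi T k \<alpha> \<epsilon>)"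
  unfolding mono_def varpi_def varpi_threshold_def mono_on_def by (auto split: if_splits)

subsection \<open>Thresholds exist\<close>

lemma mono_on_congI: "mono_on A f \<Longrightarrow> (\<And>x. x \<in> A \<Longrightarrow> g x = f x) \<Longrightarrow> mono_on A g"
  by (simp add: mono_on_def)

lemma powr_ln_powr_mono_on:
  assumes "\<delta> > 0"
  obtains T where "T > 1" "mono_on {T..} (\<lambda>t::real. t powr \<delta> * ln t powr (- c))"
proof -
  define T where "T = exp (max 1 (c / \<delta>))"
  have "T > 1" by (simp add: T_def)
  have mono: "x powr \<delta> * ln x powr (- c) \<le> y powr \<delta> * ln y powr (- c)"
    if xy: "T \<le> x" "x \<le> y" for x y
  proof (rule DERIV_nonneg_imp_nondecreasing[OF xy(2)])
    fix t assume t: "x \<le> t" "t \<le> y"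
    have t1: "t > 1" using t xy \<open>T > 1\<close> by simp
    have l: "ln t \<ge> max 1 (c / \<delta>)"
      using t xy t1 ln_mono[of T t] \<open>T > 1\<close> by (simp add: T_def)
    hence l0: "ln t > 0" by simp
    have cl: "c \<le> \<delta> * ln t" using l assms by (simp add: field_simps)
    have "((\<lambda>t. ln t powr (- c)) has_real_derivative (- c) * ln t powr (- c - 1) * (1 / t)) (at t)"
      using DERIV_chain2[OF has_real_derivative_powr[OF l0, of "- c"] DERIV_ln_divide[of t]] t1 by simp
    moreover have "((\<lambda>t. t powr \<delta>) has_real_derivative \<delta> * t powr (\<delta> - 1)) (at t)"
      using has_real_derivative_powr[of t \<delta>] t1 by simp
    ultimately have "((\<lambda>t. t powr \<delta> * ln t powr (- c)) has_real_derivative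
            (\<delta> * t powr (\<delta> - 1)) * ln t powr (- c) +
            ((- c) * ln t powr (- c - 1) * (1 / t)) * t powr \<delta>) (at t)"
      by (rule DERIV_mult[rotated])
    moreover have "(\<delta> * t powr (\<delta> - 1)) * ln t powr (- c) +
            ((- c) * ln t powr (- c - 1) * (1 / t)) * t powr \<delta>
          = t powr (\<delta> - 1) * ln t powr (- c - 1) * (\<delta> * ln t - c)"
    proof -
      have "t powr \<delta> = t powr (\<delta> - 1) * t" using t1 by (simp add: powr_diff)
      moreover have "ln t powr (- c) = ln t powr (- c - 1) * ln t" using l0 by (simp add: powr_diff)
      ultimately show ?thesis using t1 by (simp add: algebra_simps)
    qed
    ultimately show "\<exists>D. ((\<lambda>t. t powr \<delta> * ln t powr (- c)) has_real_derivative D) (at t) \<and> D \<ge> 0"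
      using cl by (intro exI conjI) auto
  qed
  show thesis using that[OF \<open>T > 1\<close>] mono by (auto intro!: mono_onI)
qed

lemma powr_prod_iter_ln_mono_on:
  assumes "\<delta> > 0"
  shows "\<exists>T. (\<forall>t\<ge>T. \<forall>j\<le>k. iter_ln j t > 0) \<and>
             mono_on {T..} (\<lambda>t. t powr \<delta> * (\<Prod>j=1..k. iter_ln j t powr (- c j)))"
  using assms
proof (induction k arbitrary: \<delta> c)
  case 0
  have "mono_on {1..} (\<lambda>t::real. t powr \<delta>)"
    using 0 by (intro mono_onI powr_mono2) auto
  moreover have "\<forall>t\<ge>1. \<forall>j\<le>0. iter_ln j t > 0" by simp
  ultimately show ?case by (intro exI[of _ 1]) simp
next
  case (Suc k)
  obtain T1 where T1: "T1 > 1" "mono_on {T1..} (\<lambda>t::real. t powr \<delta> * ln t powr (- (c 1 + 1)))"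
    using powr_ln_powr_mono_on[OF Suc.prems] by metis
  obtain T2 where T2: "\<forall>t\<ge>T2. \<forall>j\<le>k. iter_ln j t > 0"
    "mono_on {T2..} (\<lambda>t. t powr 1 * (\<Prod>j=1..k. iter_ln j t powr (- c (Suc j))))"
    using Suc.IH[of 1 "\<lambda>j. c (Suc j)"] by auto
  define T where "T = max T1 (exp T2)"
  have ln_ge: "ln t \<ge> T2" if "t \<ge> T" for t
  proof -
    have "exp T2 \<le> t" using that by (simp add: T_def)
    then show ?thesis by (smt (verit) exp_gt_zero ln_exp ln_mono)
  qed
  have gt1: "t > 1" if "t \<ge> T" for t using that T1 by (simp add: T_def)
  have pos: "iter_ln j t > 0" if "t \<ge> T" "j \<le> Suc k" for t j
  proof (cases j)
    case 0 then show ?thesis using gt1[OF that(1)] by simp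
  next
    case (Suc i)
    then show ?thesis using T2(1) ln_ge[OF that(1)] that(2)
      by (simp add: funpow_swap1 del: funpow.simps add: funpow_Suc_right)
  qed
  let ?A = "\<lambda>t::real. t powr \<delta> * ln t powr (- (c 1 + 1))"
  let ?B = "\<lambda>t::real. t powr 1 * (\<Prod>j=1..k. iter_ln j t powr (- c (Suc j)))"
  have eq: "t powr \<delta> * (\<Prod>j=1..Suc k. iter_ln j t powr (- c j)) = ?A t * ?B (ln t)" if "t \<ge> T" for t
  proof -
    have "(\<Prod>j=1..Suc k. iter_ln j t powr (- c j)) =
            ln t powr (- c 1) * (\<Prod>j=1..k. iter_ln (Suc j) t powr (- c (Suc j)))"
      by (subst prod.atLeast_Suc_atMost) (simp_all add: prod.shift_bounds_cl_Suc_ivl del: funpow.simps prod.cl_ivl_Suc,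
          simp)
    also have "(\<Prod>j=1..k. iter_ln (Suc j) t powr (- c (Suc j))) =
        (\<Prod>j=1..k. iter_ln j (ln t) powr (- c (Suc j)))"
      by (simp add: funpow_Suc_right del: funpow.simps)
    also have "ln t powr (- c 1) = ln t powr (- (c 1 + 1)) * ln t powr 1"
      using gt1[OF that] by (simp only: powr_add[symmetric]) simp
    finally show ?thesis by (simp add: mult_ac)
  qed
  have "mono_on {T..} (\<lambda>t. ?A t * ?B (ln t))"
  proof (rule mono_onI)
    fix x y assume xy: "x \<in> {T..}" "y \<in> {T..}" "x \<le> y"
    have A: "?A x \<le> ?A y" using xy by (intro mono_onD[OF T1(2)]) (auto simp: T_def)
    have "ln x \<le> ln y" using xy gt1[of x] by auto
    then have B: "?B (ln x) \<le> ?B (ln y)"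
      using xy ln_ge by (intro mono_onD[OF T2(2)]) auto
    show "?A x * ?B (ln x) \<le> ?A y * ?B (ln y)"
      by (rule mult_mono[OF A B]) (auto intro!: mult_nonneg_nonneg prod_nonneg)
  qed
  then have "mono_on {T..} (\<lambda>t. t powr \<delta> * (\<Prod>j=1..Suc k. iter_ln j t powr (- c j)))"
    by (rule mono_on_congI) (use eq in auto)
  then show ?case using pos by (intro exI[of _ T] conjI) auto
qed

lemma varpi_threshold_exists:
  assumes "\<alpha> > 0" "k \<ge> 1"
  shows "\<exists>T>0. varpi_threshold \<alpha> k \<epsilon> T"
proof -
  define c where "c j = (if j = k then 1 + \<epsilon> else 1)" for j
  obtain T where T: "\<forall>t\<ge>T. \<forall>j\<le>k. iter_ln j t > 0"
    "mono_on {T..} (\<lambda>t. t powr \<alpha> * (\<Prod>j=1..k. iter_ln j t powr (- c j)))"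
    using powr_prod_iter_ln_mono_on[OF assms(1), of k c] by blast
  have eq: "varpi_formula \<alpha> k \<epsilon> t = t powr \<alpha> * (\<Prod>j=1..k. iter_ln j t powr (- c j))" if "t \<ge> T" for t
  proof -
    have "(\<Prod>j=1..k. iter_ln j t powr (- c j)) =
          (\<Prod>j=1..k. inverse (iter_ln j t) * (if j = k then iter_ln j t powr (- \<epsilon>) else 1))"
    proof (intro prod.cong refl)
      fix j assume "j \<in> {1..k}"
      then have "iter_ln j t > 0" using T(1) that by auto
      then show "iter_ln j t powr (- c j) =
        inverse (iter_ln j t) * (if j = k then iter_ln j t powr (- \<epsilon>) else 1)"
        by (auto simp: c_def powr_minus powr_diff powr_add field_simps)
    qed
    also have "\<dots> = inverse (Lambda k t) * iter_ln k t powr (- \<epsilon>)"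
      using assms(2) by (simp add: prod.distrib Lambda_def prod_inversef[symmetric])
    finally show ?thesis by (simp add: varpi_formula_def field_simps)
  qed
  have cont: "continuous_on {T..} (iter_ln j)" if "j \<le> k" for j
    using that
  proof (induction j)
    case (Suc j)
    then have "\<forall>t\<in>{T..}. iter_ln j t \<noteq> 0" using T(1) by (metis Suc_leD atLeast_iff less_irrefl)
    then show ?case using Suc by (auto intro!: continuous_intros)
  qed (auto intro!: continuous_intros)
  have pos: "iter_ln j t > 0" if "t \<ge> T" "j \<le> k" for j t using T(1) that by auto
  have "continuous_on {T..} (varpi_formula \<alpha> k \<epsilon>)"
  proof -
    have "Lambda k t \<noteq> 0" if "t \<ge> T" for t
      unfolding Lambda_def using pos[OF that] by (auto simp: prod_zero_iff) (metis less_irrefl)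
    moreover have "t \<noteq> 0" if "t \<ge> T" for t using pos[OF that, of 0] by simp
    moreover have "iter_ln k t \<noteq> 0" if "t \<ge> T" for t using pos[OF that, of k] by simp
    moreover have "continuous_on {T..} (Lambda k)"
      unfolding Lambda_def by (intro continuous_intros cont) auto
    ultimately show ?thesis
      unfolding varpi_formula_def by (auto intro!: continuous_intros cont)
  qed
  moreover have "varpi_formula \<alpha> k \<epsilon> t > 0" if "t \<ge> T" for t
  proof -
    have "Lambda k t > 0" unfolding Lambda_def using pos[OF that] by (intro prod_pos) auto
    moreover have "t > 0" using pos[OF that, of 0] by simp
    moreover have "iter_ln k t > 0" using pos[OF that, of k] by simp
    ultimately show ?thesis by (simp add: varpi_formula_def)
  qed
  moreover have "mono_on {T..} (varpi_formula \<alpha> k \<epsilon>)"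
    by (rule mono_on_congI[OF T(2)]) (use eq in auto)
  moreover have "T > 0" using pos[of T 0] by simp
  ultimately show ?thesis using pos by (auto simp: varpi_threshold_def intro!: exI[of _ T])
qed

subsection \<open>Existence and uniqueness of the Haar measure\<close>

lemma padic_ints_lt: "x \<in> padic_ints p \<Longrightarrow> x k < p ^ k"
  by (simp add: padic_ints_def)

lemma padic_ints_mod: "x \<in> padic_ints p \<Longrightarrow> k \<le> l \<Longrightarrow> x l mod p ^ k = x k"
proof (induction l)
  case 0
  then show ?case using padic_ints_lt[of x p 0] by simp
next
  case (Suc l)
  show ?case
  proof (cases "k = Suc l")
    case True
    then show ?thesis using padic_ints_lt[OF Suc.prems(1), of "Suc l"] by simp
  next
    case False
    then have "k \<le> l" using Suc.prems by simp
    then have "x (Suc l) mod p ^ k = (x (Suc l) mod p ^ l) mod p ^ k"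
      by (simp add: mod_mod_cancel le_imp_power_dvd)
    also have "\<dots> = x k" using Suc \<open>k \<le> l\<close> by (auto simp: padic_ints_def)
    finally show ?thesis .
  qed
qed

lemma padic_add_closed:
  assumes "p > 0" "x \<in> padic_ints p" "y \<in> padic_ints p"
  shows "padic_add p x y \<in> padic_ints p"
proof -
  have "(x (Suc k) + y (Suc k)) mod p ^ Suc k mod p ^ k = (x k + y k) mod p ^ k" for k
  proof -
    have "(x (Suc k) + y (Suc k)) mod p ^ Suc k mod p ^ k = (x (Suc k) + y (Suc k)) mod p ^ k"
      by (simp add: mod_mod_cancel)
    also have "\<dots> = (x (Suc k) mod p ^ k + y (Suc k) mod p ^ k) mod p ^ k"
      by (simp add: mod_add_eq)
    also have "\<dots> = (x k + y k) mod p ^ k" using assms by (simp add: padic_ints_def)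
    finally show ?thesis .
  qed
  then show ?thesis using assms(1) by (simp add: padic_ints_def padic_add_def)
qed

lemma padic_of_int_closed:
  assumes "p > 0" shows "padic_of_int p a \<in> padic_ints p"
proof -
  have "nat (a mod int p ^ Suc k) mod p ^ k = nat (a mod int p ^ k)" for k
  proof -
    have "int (nat (a mod int p ^ Suc k) mod p ^ k) = a mod int p ^ Suc k mod int p ^ k"
      using assms by (simp add: zmod_int del: power_Suc)
    also have "\<dots> = a mod int p ^ k" by (simp add: mod_mod_cancel)
    finally show ?thesis by simp
  qed
  moreover have "nat (a mod int p ^ k) < p ^ k" for k
    using assms by (simp add: nat_less_iff)
  ultimately show ?thesis by (simp add: padic_ints_def padic_of_int_def)
qed

definition padic_cylinder :: "nat \<Rightarrow> nat \<Rightarrow> nat \<Rightarrow> (nat \<Rightarrow> nat) set" where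
  "padic_cylinder p k a = {x \<in> padic_ints p. x k = a}"

definition padic_cylinders :: "nat \<Rightarrow> (nat \<Rightarrow> nat) set set" where
  "padic_cylinders p = insert {} {padic_cylinder p k a | k a. True}"

lemma padic_cylinders_subset: "padic_cylinders p \<subseteq> Pow (padic_ints p)"
  by (auto simp: padic_cylinders_def padic_cylinder_def)

lemma Int_stable_padic_cylinders: "Int_stable (padic_cylinders p)"
proof -
  have *: "padic_cylinder p k a \<inter> padic_cylinder p l b \<in> padic_cylinders p" if "k \<le> l" for k l a b
  proof (cases "b mod p ^ k = a")
    case True
    then have "padic_cylinder p k a \<inter> padic_cylinder p l b = padic_cylinder p l b"
      using padic_ints_mod[OF _ that, of _ p] by (auto simp: padic_cylinder_def)
    then show ?thesis by (auto simp: padic_cylinders_def)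
  next
    case False
    then have "padic_cylinder p k a \<inter> padic_cylinder p l b = {}"
      using padic_ints_mod[OF _ that, of _ p] by (auto simp: padic_cylinder_def)
    then show ?thesis by (auto simp: padic_cylinders_def)
  qed
  show ?thesis
  proof (rule Int_stableI)
    fix A B assume AB: "A \<in> padic_cylinders p" "B \<in> padic_cylinders p"
    show "A \<inter> B \<in> padic_cylinders p"
    proof (cases "A = {} \<or> B = {}")
      case True
      then show ?thesis by (auto simp: padic_cylinders_def)
    next
      case False
      then obtain k a l b where "A = padic_cylinder p k a" "B = padic_cylinder p l b"
        using AB by (auto simp: padic_cylinders_def)
      then show ?thesis using *[of k l a b] *[of l k b a] by (metis Int_commute nat_le_linear)
    qed
  qed
qed

lemma sets_borel_nat: "sets (borel :: nat measure) = UNIV"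
  using borel_open[OF discrete_topology_class.open_discrete] by auto

lemma measurable_borel_nat: "measurable M (borel :: nat measure) = measurable M (count_space UNIV)"
  by (rule measurable_cong_sets) (simp_all add: sets_borel_nat)

lemma padic_coord_measurable:
  "(\<lambda>x. x k) \<in> measurable (restrict_space borel (padic_ints p)) (count_space UNIV :: nat measure)"
proof -
  have "(\<lambda>x::nat \<Rightarrow> nat. x k) \<in> borel_measurable borel"
    by (intro borel_measurable_continuous_onI) simp
  then have "(\<lambda>x::nat \<Rightarrow> nat. x k) \<in> measurable borel (count_space UNIV)"
    by (simp only: measurable_borel_nat)
  then show ?thesis by (rule measurable_restrict_space1)
qed

lemma measurable_into_padic_ints:
  assumes "\<And>x. x \<in> space M \<Longrightarrow> f x \<in> padic_ints p"
    and "\<And>k. (\<lambda>x. f x k) \<in> measurable M (count_space (UNIV :: nat set))"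
  shows "f \<in> measurable M (restrict_space borel (padic_ints p))"
proof (rule measurable_restrict_space2)
  show "f \<in> space M \<rightarrow> padic_ints p" using assms(1) by auto
  have "f \<in> measurable M (Pi\<^sub>M UNIV (\<lambda>_. borel))"
    by (rule measurable_PiM_single') (use assms(2) in \<open>auto simp: measurable_borel_nat\<close>)
  then show "f \<in> borel_measurable M"
    using measurable_cong_sets[OF refl sets_PiM_equal_borel] by blast
qed

lemma sets_padic_borel:
  "sets (restrict_space borel (padic_ints p)) = sigma_sets (padic_ints p) (padic_cylinders p)"
proof (rule antisym)
  let ?S = "sigma (padic_ints p) (padic_cylinders p)"
  have sp: "space ?S = padic_ints p" and se: "sets ?S = sigma_sets (padic_ints p) (padic_cylinders p)"
    using padic_cylinders_subset by auto
  have "(\<lambda>x. x) \<in> measurable ?S (restrict_space borel (padic_ints p))"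
  proof (rule measurable_into_padic_ints)
    fix k
    show "(\<lambda>x. x k) \<in> measurable ?S (count_space (UNIV :: nat set))"
    proof (subst measurable_count_space_eq2_countable, intro conjI ballI)
      fix a :: nat
      have "(\<lambda>x. x k) -` {a} \<inter> space ?S = padic_cylinder p k a"
        unfolding sp padic_cylinder_def by auto
      then show "(\<lambda>x. x k) -` {a} \<inter> space ?S \<in> sets ?S"
        unfolding se by (auto simp: padic_cylinders_def)
    qed simp
  qed (simp add: sp)
  from measurable_sets[OF this]
  show "sets (restrict_space borel (padic_ints p)) \<subseteq> sigma_sets (padic_ints p) (padic_cylinders p)"
    unfolding sp se using sets.sets_into_space[of _ "restrict_space borel (padic_ints p)"]
    by (simp add: subset_iff space_restrict_space Int_absorb2)
  show "sigma_sets (padic_ints p) (padic_cylinders p) \<subseteq> sets (restrict_space borel (padic_ints p))"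
  proof -
    have "padic_cylinder p k a \<in> sets (restrict_space borel (padic_ints p))" for k a
    proof -
      have "(\<lambda>x. x k) -` {a} \<inter> space (restrict_space borel (padic_ints p)) \<in>
          sets (restrict_space borel (padic_ints p))"
        by (rule measurable_sets[OF padic_coord_measurable]) simp
      moreover have "(\<lambda>x. x k) -` {a} \<inter> space (restrict_space borel (padic_ints p)) =
          padic_cylinder p k a"
        by (auto simp: space_restrict_space padic_cylinder_def)
      ultimately show ?thesis by simp
    qed
    then have "padic_cylinders p \<subseteq> sets (restrict_space borel (padic_ints p))"
      by (auto simp: padic_cylinders_def)
    from sets.sigma_sets_subset[OF this] show ?thesis by (simp add: space_restrict_space)
  qed
qed

lemma padic_add_measurable:
  assumes "p > 0" "z \<in> padic_ints p" "sets \<mu> = sets (restrict_space borel (padic_ints p))"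
  shows "padic_add p z \<in> measurable \<mu> \<mu>"
proof -
  let ?B = "restrict_space borel (padic_ints p)"
  have "padic_add p z \<in> measurable ?B ?B"
  proof (rule measurable_into_padic_ints)
    fix k
    have "(\<lambda>x. (z k + x k) mod p ^ k) \<in> measurable ?B (count_space UNIV)"
      by (rule measurable_compose[OF padic_coord_measurable]) simp
    then show "(\<lambda>x. padic_add p z x k) \<in> measurable ?B (count_space UNIV)"
      by (simp add: padic_add_def)
  qed (use assms in \<open>auto simp: space_restrict_space padic_add_closed\<close>)
  then show ?thesis using measurable_cong_sets[OF assms(3,3)] by blast
qed

lemma padic_add_vimage_cylinder:
  assumes "p > 0" "z \<in> padic_ints p" "a < p ^ k"
  shows "padic_add p z -` padic_cylinder p k a \<inter> padic_ints p =
         padic_cylinder p k ((a + (p ^ k - z k)) mod p ^ k)"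
proof -
  have z: "z k < p ^ k" using assms padic_ints_lt by blast
  have "(z k + b) mod p ^ k = a \<longleftrightarrow> b = (a + (p ^ k - z k)) mod p ^ k" if "b < p ^ k" for b
  proof
    assume "(z k + b) mod p ^ k = a"
    then have "(a + (p ^ k - z k)) mod p ^ k = (z k + b + (p ^ k - z k)) mod p ^ k"
      by (metis mod_add_left_eq)
    also have "\<dots> = b" using z that by simp
    finally show "b = (a + (p ^ k - z k)) mod p ^ k" by simp
  next
    assume "b = (a + (p ^ k - z k)) mod p ^ k"
    then have "(z k + b) mod p ^ k = (z k + (a + (p ^ k - z k))) mod p ^ k"
      by (simp add: mod_add_right_eq)
    also have "\<dots> = a" using z assms by simp
    finally show "(z k + b) mod p ^ k = a" .
  qed
  then show ?thesis
    using assms padic_ints_lt[of _ p k] padic_add_closed[of p z]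
    by (auto simp: padic_cylinder_def padic_add_def[of p z, THEN fun_cong, of _ k])
qed

lemma padic_cylinder_empty: "a \<ge> p ^ k \<Longrightarrow> padic_cylinder p k a = {}"
  by (auto simp: padic_cylinder_def dest: padic_ints_lt[of _ p k])

lemma padic_measure_eqI:
  assumes "sets \<mu> = sets (restrict_space borel (padic_ints p))"
    and "sets \<nu> = sets (restrict_space borel (padic_ints p))"
    and "prob_space \<mu>"
    and "\<And>k a. a < p ^ k \<Longrightarrow> emeasure \<mu> (padic_cylinder p k a) = emeasure \<nu> (padic_cylinder p k a)"
  shows "\<mu> = \<nu>"
proof (rule measure_eqI_generator_eq[OF Int_stable_padic_cylinders padic_cylinders_subset])
  show "sets \<mu> = sigma_sets (padic_ints p) (padic_cylinders p)"
    "sets \<nu> = sigma_sets (padic_ints p) (padic_cylinders p)"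
    using assms(1,2) sets_padic_borel by auto
  show "emeasure \<mu> X = emeasure \<nu> X" if "X \<in> padic_cylinders p" for X
  proof -
    consider "X = {}" | k a where "X = padic_cylinder p k a"
      using \<open>X \<in> padic_cylinders p\<close> by (auto simp: padic_cylinders_def)
    then show ?thesis
    proof cases
      case (2 k a)
      then show ?thesis using assms(4)[of a k] padic_cylinder_empty[of p k a] by (cases "a < p ^ k") auto
    qed simp
  qed
  have eq: "padic_cylinder p 0 0 = padic_ints p"
    using padic_ints_lt[of _ p 0] by (auto simp: padic_cylinder_def)
  show "(\<Union>i::nat. padic_cylinder p 0 0) = padic_ints p" using eq by auto
  show "range (\<lambda>i::nat. padic_cylinder p 0 0) \<subseteq> padic_cylinders p"
    by (auto simp: padic_cylinders_def)
  show "emeasure \<mu> (padic_cylinder p 0 0) \<noteq> \<infinity>"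
  proof -
    interpret prob_space \<mu> by fact
    show ?thesis by simp
  qed
qed

lemma padic_cylinder_sets:
  assumes "sets \<mu> = sets (restrict_space borel (padic_ints p))"
  shows "padic_cylinder p k a \<in> sets \<mu>"
  unfolding assms sets_padic_borel by (auto simp: padic_cylinders_def)

lemma padic_haar_measure_cylinder:
  assumes "p > 0" "padic_haar_measure p \<mu>" "a < p ^ k"
  shows "emeasure \<mu> (padic_cylinder p k a) = ennreal (1 / real (p ^ k))"
proof -
  have sets: "sets \<mu> = sets (restrict_space borel (padic_ints p))" and "prob_space \<mu>"
    and inv: "\<And>z. z \<in> padic_ints p \<Longrightarrow> distr \<mu> \<mu> (padic_add p z) = \<mu>"
    using assms by (auto simp: padic_haar_measure_def)
  interpret prob_space \<mu> by fact
  have sp: "space \<mu> = padic_ints p"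
    using sets_eq_imp_space_eq[OF sets] by (simp add: space_restrict_space)
  have same: "emeasure \<mu> (padic_cylinder p k b) = emeasure \<mu> (padic_cylinder p k 0)" if "b < p ^ k" for b
  proof -
    have z: "padic_of_int p (int b) \<in> padic_ints p" by (rule padic_of_int_closed[OF assms(1)])
    have zk: "padic_of_int p (int b) k = b"
      using that by (simp add: padic_of_int_def flip: of_nat_power zmod_int)
    have "emeasure \<mu> (padic_cylinder p k b) =
        emeasure (distr \<mu> \<mu> (padic_add p (padic_of_int p (int b)))) (padic_cylinder p k b)"
      using inv[OF z] by simp
    also have "\<dots> = emeasure \<mu> (padic_add p (padic_of_int p (int b)) -` padic_cylinder p k b \<inter> space \<mu>)"
      by (rule emeasure_distr[OF padic_add_measurable[OF assms(1) z sets] padic_cylinder_sets[OF sets]])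
    also have "\<dots> = emeasure \<mu> (padic_cylinder p k 0)"
      unfolding sp padic_add_vimage_cylinder[OF assms(1) z that] zk using that by simp
    finally show ?thesis .
  qed
  have "1 = emeasure \<mu> (space \<mu>)" using emeasure_space_1 by simp
  also have "space \<mu> = (\<Union>b\<in>{..<p ^ k}. padic_cylinder p k b)"
    unfolding sp using padic_ints_lt[of _ p k] by (auto simp: padic_cylinder_def)
  also have "emeasure \<mu> \<dots> = (\<Sum>b\<in>{..<p ^ k}. emeasure \<mu> (padic_cylinder p k b))"
    by (rule sum_emeasure[symmetric])
       (use padic_cylinder_sets[OF sets] in \<open>auto simp: disjoint_family_on_def padic_cylinder_def\<close>)
  also have "\<dots> = (\<Sum>b\<in>{..<p ^ k}. emeasure \<mu> (padic_cylinder p k 0))"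
    by (intro sum.cong) (use same in auto)
  also have "\<dots> = ennreal (real (p ^ k)) * emeasure \<mu> (padic_cylinder p k 0)"
    by (simp add: ennreal_of_nat_eq_real_of_nat)
  also have "\<dots> = ennreal (real (p ^ k) * prob (padic_cylinder p k 0))"
    by (simp add: emeasure_eq_measure ennreal_mult')
  finally have "real (p ^ k) * prob (padic_cylinder p k 0) = 1"
    by (metis ennreal_1 ennreal_inj measure_nonneg mult_nonneg_nonneg of_nat_0_le_iff zero_le_one)
  then have "prob (padic_cylinder p k 0) = 1 / real (p ^ k)"
    using assms(1) by (simp add: field_simps)
  then show ?thesis using same[OF assms(3)] by (simp add: emeasure_eq_measure)
qed

definition padic_of_digits :: "nat \<Rightarrow> (nat \<Rightarrow> nat) \<Rightarrow> nat \<Rightarrow> nat" where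
  "padic_of_digits p d = (\<lambda>k. \<Sum>i<k. d i * p ^ i)"

lemma padic_of_digits_lt:
  assumes "\<And>i. d i < p"
  shows "padic_of_digits p d k < p ^ k"
proof (induction k)
  case (Suc k)
  have "padic_of_digits p d (Suc k) < p ^ k + d k * p ^ k" using Suc by (simp add: padic_of_digits_def)
  also have "\<dots> = Suc (d k) * p ^ k" by simp
  also have "\<dots> \<le> p * p ^ k" using assms[of k] by (intro mult_right_mono) auto
  finally show ?case by simp
qed (simp add: padic_of_digits_def)

lemma padic_of_digits_closed:
  assumes "\<And>i. d i < p" shows "padic_of_digits p d \<in> padic_ints p"
proof -
  have "padic_of_digits p d (Suc k) = padic_of_digits p d k + d k * p ^ k" for k
    by (simp add: padic_of_digits_def)
  then show ?thesis using padic_of_digits_lt[OF assms] by (simp add: padic_ints_def)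
qed

lemma padic_of_digits_eq_iff:
  assumes "\<And>i. d i < p" "a < p ^ k"
  shows "padic_of_digits p d k = a \<longleftrightarrow> (\<forall>i<k. d i = (a div p ^ i) mod p)"
  using assms(2)
proof (induction k arbitrary: a)
  case 0
  then show ?case by (simp add: padic_of_digits_def)
next
  case (Suc k)
  have p: "p > 0" using assms(1)[of 0] by simp
  have S: "padic_of_digits p d (Suc k) = padic_of_digits p d k + d k * p ^ k"
    by (simp add: padic_of_digits_def)
  have lt: "padic_of_digits p d k < p ^ k" by (rule padic_of_digits_lt[OF assms(1)])
  have "padic_of_digits p d (Suc k) = a \<longleftrightarrow>
      padic_of_digits p d k = a mod p ^ k \<and> d k = a div p ^ k"
  proof
    assume "padic_of_digits p d (Suc k) = a"
    then have "a = padic_of_digits p d k + d k * p ^ k" using S by simp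
    then show "padic_of_digits p d k = a mod p ^ k \<and> d k = a div p ^ k"
      using lt p by simp
  next
    assume "padic_of_digits p d k = a mod p ^ k \<and> d k = a div p ^ k"
    then show "padic_of_digits p d (Suc k) = a" using S mod_div_mult_eq[of a "p ^ k"] by simp
  qed
  also have "\<dots> \<longleftrightarrow> (\<forall>i<k. d i = (a mod p ^ k div p ^ i) mod p) \<and> d k = (a div p ^ k) mod p"
  proof -
    have "a div p ^ k < p" using Suc.prems p by (simp add: less_mult_imp_div_less)
    then show ?thesis using Suc.IH[of "a mod p ^ k"] p by simp
  qed
  also have "\<dots> \<longleftrightarrow> (\<forall>i<Suc k. d i = (a div p ^ i) mod p)"
  proof -
    have "(a mod p ^ k div p ^ i) mod p = (a div p ^ i) mod p" if "i < k" for i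
    proof -
      have k: "p ^ k = p ^ i * (p * p ^ (k - Suc i))"
        using that by (metis Suc_leI le_add_diff_inverse power_Suc power_add mult.assoc mult.commute)
      have "a mod p ^ k = p ^ i * (a div p ^ i mod (p * p ^ (k - Suc i))) + a mod p ^ i"
        unfolding k by (rule mod_mult2_eq)
      then have "a mod p ^ k div p ^ i = a div p ^ i mod (p * p ^ (k - Suc i))"
        using p by simp
      then show ?thesis by (simp add: mod_mod_cancel)
    qed
    then show ?thesis by (auto simp: less_Suc_eq)
  qed
  finally show ?case .
qed

lemma padic_haar_measure_exists:
  assumes "p > 0" shows "\<exists>\<mu>. padic_haar_measure p \<mu>"
proof -
  let ?U = "uniform_count_measure {..<p}"
  let ?P = "Pi\<^sub>M (UNIV :: nat set) (\<lambda>_. ?U)"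
  let ?B = "restrict_space borel (padic_ints p)"
  have U: "prob_space ?U" using assms by (intro prob_space_uniform_count_measure) auto
  interpret product_prob_space "\<lambda>_. ?U" "UNIV :: nat set"
    using U by (simp add: product_prob_space_def product_prob_space_axioms_def
        product_sigma_finite_def prob_space_imp_sigma_finite)
  have dig: "d i < p" if "d \<in> space ?P" for d i
    using that by (auto simp: space_PiM PiE_iff space_uniform_count_measure)
  have meas: "padic_of_digits p \<in> measurable ?P ?B"
  proof (rule measurable_into_padic_ints)
    show "padic_of_digits p d \<in> padic_ints p" if "d \<in> space ?P" for d
      using padic_of_digits_closed dig[OF that] by blast
    fix k
    have c: "(\<lambda>d. d i) \<in> measurable ?P (count_space UNIV)" for i
    proof -
      have "(\<lambda>d. d i) \<in> measurable ?P ?U" by (rule measurable_component_singleton) simp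
      moreover have "(\<lambda>x. x) \<in> measurable ?U (count_space UNIV)"
        by (simp add: measurable_def sets_uniform_count_measure space_uniform_count_measure)
      ultimately show ?thesis by (rule measurable_compose)
    qed
    show "(\<lambda>d. padic_of_digits p d k) \<in> measurable ?P (count_space UNIV)"
      unfolding padic_of_digits_def
    proof (induction k)
      case (Suc k)
      have "(\<lambda>d. (\<Sum>i<k. d i * p ^ i) + b * p ^ k) \<in> measurable ?P (count_space UNIV)" for b
        by (rule measurable_compose[OF Suc]) simp
      from measurable_compose_countable[OF this c[of k]] show ?case by simp
    qed simp
  qed
  define \<mu> where "\<mu> = distr ?P ?B (padic_of_digits p)"
  have sets: "sets \<mu> = sets ?B" and sp: "space \<mu> = padic_ints p"
    by (simp_all add: \<mu>_def space_restrict_space)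
  have prob: "prob_space \<mu>" unfolding \<mu>_def by (rule P.prob_space_distr[OF meas])
  have cyl: "emeasure \<mu> (padic_cylinder p k a) = ennreal (1 / real p) ^ k" if "a < p ^ k" for k a
  proof -
    have "emeasure \<mu> (padic_cylinder p k a) =
        emeasure ?P (padic_of_digits p -` padic_cylinder p k a \<inter> space ?P)"
      unfolding \<mu>_def by (rule emeasure_distr[OF meas padic_cylinder_sets[OF refl]])
    also have "padic_of_digits p -` padic_cylinder p k a \<inter> space ?P =
        {d \<in> space ?P. \<forall>i\<in>{..<k}. d i \<in> {(a div p ^ i) mod p}}"
    proof (rule Set.set_eqI)
      fix d
      show "d \<in> padic_of_digits p -` padic_cylinder p k a \<inter> space ?P \<longleftrightarrow>
        d \<in> {d \<in> space ?P. \<forall>i\<in>{..<k}. d i \<in> {(a div p ^ i) mod p}}"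
      proof (cases "d \<in> space ?P")
        case True
        then show ?thesis
          using padic_of_digits_eq_iff[of d p a k] padic_of_digits_closed[of d p] dig that
          by (auto simp: padic_cylinder_def)
      qed simp
    qed
    also have "emeasure ?P \<dots> = (\<Prod>i\<in>{..<k}. emeasure ?U {(a div p ^ i) mod p})"
      by (rule emeasure_PiM_Collect) (use assms in \<open>auto simp: sets_uniform_count_measure\<close>)
    also have "\<dots> = (\<Prod>i\<in>{..<k}. ennreal (1 / real p))"
      using assms by (intro prod.cong refl) (simp add: emeasure_uniform_count_measure)
    finally show ?thesis by simp
  qed
  have "distr \<mu> \<mu> (padic_add p z) = \<mu>" if z: "z \<in> padic_ints p" for z
  proof (rule padic_measure_eqI)
    have meas: "padic_add p z \<in> measurable \<mu> \<mu>" by (rule padic_add_measurable[OF assms z sets])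
    show "prob_space (distr \<mu> \<mu> (padic_add p z))" by (rule prob_space.prob_space_distr[OF prob meas])
    fix k a assume a: "a < p ^ k"
    have "emeasure (distr \<mu> \<mu> (padic_add p z)) (padic_cylinder p k a) =
        emeasure \<mu> (padic_add p z -` padic_cylinder p k a \<inter> space \<mu>)"
      by (rule emeasure_distr[OF meas padic_cylinder_sets[OF sets]])
    also have "\<dots> = emeasure \<mu> (padic_cylinder p k ((a + (p ^ k - z k)) mod p ^ k))"
      unfolding sp padic_add_vimage_cylinder[OF assms z a] ..
    also have "\<dots> = emeasure \<mu> (padic_cylinder p k a)"
      using cyl[OF a] cyl[of "(a + (p ^ k - z k)) mod p ^ k" k] assms by simp
    finally show "emeasure (distr \<mu> \<mu> (padic_add p z)) (padic_cylinder p k a) =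
        emeasure \<mu> (padic_cylinder p k a)" .
  qed (simp_all add: sets)
  then show ?thesis using sets prob unfolding padic_haar_measure_def by blast
qed

lemma padic_haar_measure_unique:
  assumes "p > 0" "padic_haar_measure p \<mu>" "padic_haar_measure p \<nu>"
  shows "\<mu> = \<nu>"
proof (rule padic_measure_eqI)
  show "emeasure \<mu> (padic_cylinder p k a) = emeasure \<nu> (padic_cylinder p k a)" if "a < p ^ k" for k a
    using padic_haar_measure_cylinder[OF assms(1,2) that] padic_haar_measure_cylinder[OF assms(1,3) that]
    by simp
qed (use assms in \<open>auto simp: padic_haar_measure_def\<close>)

lemma padic_haar_measure_padic_haar:
  assumes "p > 0" shows "padic_haar_measure p (padic_haar p)"
  unfolding padic_haar_def
proof (rule theI')
  show "\<exists>!\<mu>. padic_haar_measure p \<mu>"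
    using padic_haar_measure_exists[OF assms] padic_haar_measure_unique[OF assms] by blast
qed

lemma
  assumes "p > 0"
  shows sets_padic_haar: "sets (padic_haar p) = sets (restrict_space borel (padic_ints p))"
    and space_padic_haar: "space (padic_haar p) = padic_ints p"
    and prob_space_padic_haar: "prob_space (padic_haar p)"
    and distr_padic_haar:
      "z \<in> padic_ints p \<Longrightarrow> distr (padic_haar p) (padic_haar p) (padic_add p z) = padic_haar p"
proof -
  note * = padic_haar_measure_padic_haar[OF assms, unfolded padic_haar_measure_def]
  show "sets (padic_haar p) = sets (restrict_space borel (padic_ints p))" using * by blast
  from sets_eq_imp_space_eq[OF this] show "space (padic_haar p) = padic_ints p"
    by (simp add: space_restrict_space)
  show "prob_space (padic_haar p)" using * by blast
  show "distr (padic_haar p) (padic_haar p) (padic_add p z) = padic_haar p" if "z \<in> padic_ints p"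
    using * that by blast
qed

subsection \<open>Adding machines are free probability measure-preserving actions\<close>

lemma padic_of_int_add:
  assumes "p > 0"
  shows "padic_add p (padic_of_int p a) (padic_add p (padic_of_int p b) x) =
         padic_add p (padic_of_int p (a + b)) x"
proof
  fix k
  have "int (padic_add p (padic_of_int p a) (padic_add p (padic_of_int p b) x) k) =
      (a mod int p ^ k + (b mod int p ^ k + int (x k)) mod int p ^ k) mod int p ^ k"
    using assms by (simp add: padic_add_def padic_of_int_def zmod_int)
  also have "\<dots> = ((a + b) mod int p ^ k + int (x k)) mod int p ^ k"
    by (simp add: mod_simps add.assoc)
  also have "\<dots> = int (padic_add p (padic_of_int p (a + b)) x k)"
    using assms by (simp add: padic_add_def padic_of_int_def zmod_int)
  finally show "padic_add p (padic_of_int p a) (padic_add p (padic_of_int p b) x) k =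
      padic_add p (padic_of_int p (a + b)) x k" by simp
qed

lemma padic_add_of_int_0: "x \<in> padic_ints p \<Longrightarrow> padic_add p (padic_of_int p 0) x = x"
  by (auto simp: padic_add_def padic_of_int_def padic_ints_def)

lemma padic_add_of_int_fixed:
  assumes "p \<ge> 2" "x \<in> padic_ints p" "padic_add p (padic_of_int p a) x = x"
  shows "a = 0"
proof -
  have "int p ^ k dvd a" for k
  proof -
    have "int (padic_add p (padic_of_int p a) x k) = int (x k)" using assms(3) by simp
    then have "(a mod int p ^ k + int (x k)) mod int p ^ k = int (x k)"
      using assms(1) by (simp add: padic_add_def padic_of_int_def zmod_int)
    then have "(a + int (x k)) mod int p ^ k = int (x k) mod int p ^ k"
      using padic_ints_lt[OF assms(2), of k] by (simp add: mod_simps flip: of_nat_power)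
    then show ?thesis by (simp add: mod_eq_dvd_iff)
  qed
  then have "int p ^ nat \<bar>a\<bar> dvd \<bar>a\<bar>" by simp
  moreover have "\<bar>a\<bar> < int p ^ nat \<bar>a\<bar>"
  proof -
    have "nat \<bar>a\<bar> < 2 ^ nat \<bar>a\<bar>" by (rule less_exp)
    also have "\<dots> \<le> p ^ nat \<bar>a\<bar>" using assms(1) by (intro power_mono) auto
    finally have "int (nat \<bar>a\<bar>) < int (p ^ nat \<bar>a\<bar>)" by (simp only: of_nat_less_iff)
    then show ?thesis by simp
  qed
  ultimately show ?thesis using zdvd_not_zless[of "\<bar>a\<bar>" "int p ^ nat \<bar>a\<bar>"] by auto
qed

lemma space_padic_space:
  "p > 0 \<Longrightarrow> space (padic_space p d) = (\<Pi>\<^sub>E i\<in>{..<d}. padic_ints p)"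
  by (simp add: padic_space_def space_PiM space_padic_haar)

lemma adding_machine_apply:
  "z \<in> space (padic_space p d) \<Longrightarrow>
    adding_machine p d g z = (\<lambda>i\<in>{..<d}. padic_add p (padic_of_int p (g i)) (z i))"
  by (simp add: adding_machine_def)

lemma adding_machine_closed:
  assumes "p > 0" "z \<in> space (padic_space p d)"
  shows "adding_machine p d g z \<in> space (padic_space p d)"
  unfolding adding_machine_apply[OF assms(2)] using assms
  by (auto simp: space_padic_space PiE_mem intro!: padic_add_closed padic_of_int_closed)

lemma adding_machine_compose:
  assumes "p > 0"
  shows "compose (space (padic_space p d)) (adding_machine p d g) (adding_machine p d h) =
    adding_machine p d (\<lambda>i\<in>{..<d}. g i + h i)"
proof
  fix z
  show "compose (space (padic_space p d)) (adding_machine p d g) (adding_machine p d h) z =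
      adding_machine p d (\<lambda>i\<in>{..<d}. g i + h i) z"
  proof (cases "z \<in> space (padic_space p d)")
    case True
    note adding_machine_apply[OF this, simp]
    have "adding_machine p d g (adding_machine p d h z) =
        (\<lambda>i\<in>{..<d}. padic_add p (padic_of_int p (g i)) (adding_machine p d h z i))"
      by (rule adding_machine_apply[OF adding_machine_closed[OF assms True]])
    also have "\<dots> = adding_machine p d (\<lambda>i\<in>{..<d}. g i + h i) z"
      by (auto simp: padic_of_int_add[OF assms] intro!: restrict_ext)
    finally show ?thesis using True by (simp only: compose_eq)
  next
    case False
    then show ?thesis by (simp only: compose_def adding_machine_def restrict_apply if_False)
  qed
qed

lemma adding_machine_zero:
  assumes "p > 0" "z \<in> space (padic_space p d)"
  shows "adding_machine p d (\<lambda>i\<in>{..<d}. 0) z = z"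
proof -
  have z: "z \<in> (\<Pi>\<^sub>E i\<in>{..<d}. padic_ints p)" using assms by (simp only: space_padic_space)
  have "(\<lambda>i\<in>{..<d}. padic_add p (padic_of_int p 0) (z i)) = (\<lambda>i\<in>{..<d}. z i)"
    by (rule restrict_ext) (rule padic_add_of_int_0[OF PiE_mem[OF z]])
  also have "\<dots> = z" by (rule PiE_restrict[OF z])
  finally have "(\<lambda>i\<in>{..<d}. padic_add p (padic_of_int p 0) (z i)) = z" .
  moreover have "adding_machine p d (\<lambda>i\<in>{..<d}. 0) z =
      (\<lambda>i\<in>{..<d}. padic_add p (padic_of_int p 0) (z i))"
    unfolding adding_machine_apply[OF assms(2)] by (rule restrict_ext) simp
  ultimately show ?thesis by simp
qed

lemma adding_machine_Bij:
  assumes "p > 0"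
  shows "adding_machine p d g \<in> Bij (space (padic_space p d))"
proof -
  let ?S = "space (padic_space p d)"
  have comp: "adding_machine p d g' (adding_machine p d h z) =
      adding_machine p d (\<lambda>i\<in>{..<d}. g' i + h i) z" if "z \<in> ?S" for g' h z
    using that by (simp only: adding_machine_compose[OF assms, symmetric] compose_eq)
  have inv: "adding_machine p d g (adding_machine p d (\<lambda>i. - g i) z) = z"
    "adding_machine p d (\<lambda>i. - g i) (adding_machine p d g z) = z" if "z \<in> ?S" for z
    using adding_machine_zero[OF assms that] by (simp_all add: comp[OF that])
  have "bij_betw (adding_machine p d g) ?S ?S"
    by (rule bij_betw_byWitness[where f' = "adding_machine p d (\<lambda>i. - g i)"])
       (use inv adding_machine_closed[OF assms] in auto)
  moreover have "adding_machine p d g \<in> extensional ?S" by (simp add: adding_machine_def)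
  ultimately show ?thesis by (simp add: Bij_def)
qed

lemma group_action_adding_machine:
  assumes "p > 0"
  shows "group_action (Zpow d) (space (padic_space p d)) (adding_machine p d)"
proof -
  have "group_hom (Zpow d) (BijGroup (space (padic_space p d))) (adding_machine p d)"
  proof (rule group_hom.intro)
    show "group (Zpow d)" by (rule product_group) (rule group_integer_group)
    show "group (BijGroup (space (padic_space p d)))" by (rule group_BijGroup)
    show "group_hom_axioms (Zpow d) (BijGroup (space (padic_space p d))) (adding_machine p d)"
    proof (rule group_hom_axioms.intro, rule homI)
      fix g h
      show "adding_machine p d g \<in> carrier (BijGroup (space (padic_space p d)))"
        using adding_machine_Bij[OF assms] by (simp add: BijGroup_def)
      show "adding_machine p d (g \<otimes>\<^bsub>Zpow d\<^esub> h) =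
          adding_machine p d g \<otimes>\<^bsub>BijGroup (space (padic_space p d))\<^esub> adding_machine p d h"
        by (simp add: BijGroup_def adding_machine_Bij[OF assms] adding_machine_compose[OF assms]
            del: restrict_apply) (simp add: adding_machine_Bij[OF assms] adding_machine_compose[OF assms])
    qed
  qed
  then show ?thesis by (rule group_action.intro)
qed

lemma prob_space_padic_space:
  assumes "p > 0" shows "prob_space (padic_space p d)"
  unfolding padic_space_def by (intro prob_space_PiM prob_space_padic_haar assms)

lemma padic_add_of_int_measurable:
  assumes "p > 0"
  shows "padic_add p (padic_of_int p a) \<in> measurable (padic_haar p) (padic_haar p)"
  by (rule padic_add_measurable[OF assms padic_of_int_closed[OF assms] sets_padic_haar[OF assms]])

lemma adding_machine_measurable:
  assumes "p > 0"
  shows "adding_machine p d g \<in> measurable (padic_space p d) (padic_space p d)"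
proof -
  have "(\<lambda>z. \<lambda>i\<in>{..<d}. padic_add p (padic_of_int p (g i)) (z i)) \<in>
      measurable (padic_space p d) (padic_space p d)"
    unfolding padic_space_def
    by (intro measurable_restrict measurable_compose[OF _ padic_add_of_int_measurable[OF assms]]
        measurable_component_singleton) auto
  then show ?thesis
    by (rule measurable_cong[THEN iffD1, rotated]) (simp add: adding_machine_def)
qed

lemma distr_adding_machine:
  assumes "p > 0"
  shows "distr (padic_space p d) (padic_space p d) (adding_machine p d g) = padic_space p d"
proof -
  let ?H = "padic_haar p" and ?M = "padic_space p d"
  interpret H: prob_space ?H by (rule prob_space_padic_haar[OF assms])
  interpret product_sigma_finite "\<lambda>_::nat. ?H"
    by (simp add: product_sigma_finite_def H.sigma_finite_measure_axioms)
  let ?f = "\<lambda>i. padic_add p (padic_of_int p (g i))"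
  have "distr ?M ?M (adding_machine p d g) = Pi\<^sub>M {..<d} (\<lambda>_. ?H)"
  proof (rule PiM_eqI)
    fix A assume A: "\<And>i. i \<in> {..<d} \<Longrightarrow> A i \<in> sets ?H"
    have f: "?f i -` A i \<inter> space ?H \<in> sets ?H" if "i \<in> {..<d}" for i
      by (rule measurable_sets[OF padic_add_of_int_measurable[OF assms] A[OF that]])
    have "emeasure (distr ?M ?M (adding_machine p d g)) (Pi\<^sub>E {..<d} A) =
        emeasure ?M (adding_machine p d g -` Pi\<^sub>E {..<d} A \<inter> space ?M)"
      by (rule emeasure_distr[OF adding_machine_measurable[OF assms]])
         (use A in \<open>auto simp: padic_space_def intro!: sets_PiM_I_finite\<close>)
    also have "adding_machine p d g -` Pi\<^sub>E {..<d} A \<inter> space ?M =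
        Pi\<^sub>E {..<d} (\<lambda>i. ?f i -` A i \<inter> space ?H)"
    proof (rule Set.set_eqI)
      fix z
      show "z \<in> adding_machine p d g -` Pi\<^sub>E {..<d} A \<inter> space ?M \<longleftrightarrow>
          z \<in> Pi\<^sub>E {..<d} (\<lambda>i. ?f i -` A i \<inter> space ?H)"
      proof (cases "z \<in> space ?M")
        case True
        then have z: "z \<in> (\<Pi>\<^sub>E i\<in>{..<d}. padic_ints p)" by (simp add: space_padic_space assms)
        have "adding_machine p d g z \<in> Pi\<^sub>E {..<d} A \<longleftrightarrow> (\<forall>i<d. ?f i (z i) \<in> A i)"
          unfolding adding_machine_apply[OF True] by (simp add: PiE_iff Ball_def)
        then show ?thesis using True z by (auto simp: PiE_iff space_padic_haar assms)
      next
        case False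
        then show ?thesis by (auto simp: space_padic_space space_padic_haar assms PiE_iff)
      qed
    qed
    also have "emeasure ?M \<dots> = (\<Prod>i<d. emeasure ?H (?f i -` A i \<inter> space ?H))"
      unfolding padic_space_def by (rule emeasure_PiM) (use f in auto)
    also have "\<dots> = (\<Prod>i<d. emeasure ?H (A i))"
    proof (intro prod.cong refl)
      fix i assume i: "i \<in> {..<d}"
      have "emeasure ?H (?f i -` A i \<inter> space ?H) = emeasure (distr ?H ?H (?f i)) (A i)"
        by (rule emeasure_distr[OF padic_add_of_int_measurable[OF assms] A[OF i], symmetric])
      then show "emeasure ?H (?f i -` A i \<inter> space ?H) = emeasure ?H (A i)"
        by (simp add: distr_padic_haar assms padic_of_int_closed)
    qed
    finally show "emeasure (distr ?M ?M (adding_machine p d g)) (Pi\<^sub>E {..<d} A) =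
        (\<Prod>i<d. emeasure ?H (A i))" .
  qed (auto simp: padic_space_def)
  then show ?thesis by (simp add: padic_space_def)
qed

lemma free_pmp_action_adding_machine:
  assumes "prime p"
  shows "free_pmp_action (Zpow d) (padic_space p d) (adding_machine p d)"
proof -
  have p: "p > 0" "p \<ge> 2" using assms prime_gt_0_nat prime_ge_2_nat by auto
  have "g = \<one>\<^bsub>Zpow d\<^esub>"
    if z: "z \<in> space (padic_space p d)" and g: "g \<in> carrier (Zpow d)"
      and eq: "adding_machine p d g z = z" for g z
  proof -
    have "g i = 0" if "i < d" for i
    proof (rule padic_add_of_int_fixed[OF p(2)])
      show "z i \<in> padic_ints p" using z that by (auto simp: space_padic_space p(1))
      show "padic_add p (padic_of_int p (g i)) (z i) = z i"
        using fun_cong[OF eq, of i] z that by (simp add: adding_machine_def)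
    qed
    then show ?thesis using g by (auto simp: PiE_iff extensional_def fun_eq_iff)
  qed
  then have "AE z in padic_space p d. \<forall>g\<in>carrier (Zpow d).
      adding_machine p d g z = z \<longrightarrow> g = \<one>\<^bsub>Zpow d\<^esub>"
    by (intro AE_I2) blast
  then show ?thesis
    by (intro free_pmp_action.intro free_pmp_action_axioms.intro group_action_adding_machine
        prob_space_padic_space adding_machine_measurable distr_adding_machine p(1))
qed

end

theory Submission
  imports Defs
begin

text \<open>
  Writing out base \<open>p\<close> digits identifies \<open>\<int>\<^sub>p\<^sup>n\<close> with the space of digit streams
  \<open>s 0, s 1, \<dots>\<close>, where position \<open>l * n + i\<close> holds digit \<open>l\<close> of coordinate \<open>i\<close>, and Haar
  measure with the uniform Bernoulli measure. Reading the same stream in \<open>\<int>\<^sub>p\<^sup>m\<close> gives a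
  measure isomorphism \<open>\<int>\<^sub>p\<^sup>n \<rightarrow> \<int>\<^sub>p\<^sup>m\<close>, the \<^emph>\<open>shuffle\<close>, whose inverse is the shuffle with the
  roles of \<open>n\<close> and \<open>m\<close> exchanged (\<open>shuffle_shuffle\<close>, \<open>distr_shuffle\<close>). It depends on
  nothing but \<open>p\<close>, \<open>n\<close> and \<open>m\<close>, so it serves all \<open>\<epsilon>\<close> and \<open>k\<close> at once.

  Almost surely, adding \<open>g \<in> \<int>\<^sup>n\<close> changes only finitely many digits: if no carry reaches level \<open>l\<close>,
  only stream positions below \<open>l * n\<close> are affected. Conversely two points of \<open>\<int>\<^sub>p\<close> whose digits agree
  from level \<open>L\<close> on differ by an integer of absolute value less than \<open>p ^ L\<close>. Positions below
  \<open>l * n\<close> are digits of level about \<open>l * n / m\<close> at most in \<open>\<int>\<^sub>p\<^sup>m\<close>. Hence the shuffle maps orbits to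
  orbits, and up to a constant factor its cocycle is at most \<open>b ^ l\<close> with \<open>b = p powr (n / m)\<close>, unless
  a carry reaches level \<open>l\<close> (\<open>shuffle_adding_machine\<close>).

  A carry reaches level \<open>l\<close> with probability at most \<open>\<bar>g\<bar> / p ^ l\<close> (\<open>emeasure_carry\<close>), so for a
  nondecreasing \<open>\<omega>\<close> the integral of \<open>\<omega>\<close> of the rescaled cocycle is bounded by a constant times the
  sum of the \<open>\<omega> (b ^ l) / p ^ l\<close>. For \<open>\<omega> = \<varpi>\<close> with exponent \<open>m / n\<close> the power
  \<open>(b ^ l) powr (m / n)\<close> cancels \<open>p ^ l\<close> exactly. Since \<open>ln (b ^ l)\<close> is proportional to \<open>l\<close>, what
  remains is the Bertrand series of terms
  \<open>1 / (u * ln u * \<dots> * (iter_ln (k - 1) u) powr (1 + \<epsilon>))\<close> along an arithmetic progression of \<open>u\<close>,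
  which converges (\<open>summable_iter_ln\<close>).
\<close>

section \<open>Bertrand series with iterated logarithms\<close>

lemma filterlim_iter_ln_at_top: "filterlim (iter_ln j) at_top at_top"
proof (induction j)
  case 0
  then show ?case by (simp add: filterlim_ident)
next
  case (Suc j)
  then show ?case by (auto intro: filterlim_compose[OF ln_at_top])
qed

lemma eventually_iter_ln_pos:
  "eventually (\<lambda>u. \<forall>j\<le>k. iter_ln j u > 0) at_top"
proof -
  have "eventually (\<lambda>u. \<forall>j\<in>{..k}. iter_ln j u > 0) at_top"
    by (rule eventually_ball_finite)
      (use filterlim_iter_ln_at_top in \<open>auto simp: filterlim_at_top_dense\<close>)
  then show ?thesis by (rule eventually_mono) auto
qed

lemma iter_ln_mono:
  assumes "\<forall>j<k. iter_ln j u > 0" "u \<le> v"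
  shows "iter_ln k u \<le> iter_ln k v"
  using assms by (induction k) (auto simp: intro!: ln_mono)

lemma DERIV_iter_ln:
  assumes "\<forall>j<k. iter_ln j u > 0"
  shows "(iter_ln k has_real_derivative (\<Prod>j<k. inverse (iter_ln j u))) (at u)"
  using assms
proof (induction k)
  case 0
  then show ?case by (simp add: DERIV_ident)
next
  case (Suc k)
  then have "iter_ln k u > 0" "(iter_ln k has_real_derivative (\<Prod>j<k. inverse (iter_ln j u))) (at u)"
    by auto
  from DERIV_chain2[OF DERIV_ln[OF this(1)] this(2)] show ?case
    by (simp add: mult.commute)
qed

text \<open>
  With \<open>f\<close> for the summand, \<open>- \<epsilon> * f\<close> is the derivative of
  \<open>F u = iter_ln k u powr (- \<epsilon>)\<close>, which tends to \<open>0\<close>. As \<open>f\<close> is eventually decreasing, the mean value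
  theorem bounds each term by a difference of consecutive values of \<open>F\<close>, and these telescope.
\<close>

lemma summable_iter_ln:
  assumes "a > 0" "\<epsilon> > 0"
  shows "summable (\<lambda>l. (\<Prod>j<k. inverse (iter_ln j (real l * a))) * iter_ln k (real l * a) powr (- \<epsilon> - 1))"
proof -
  define f where "f u = (\<Prod>j<k. inverse (iter_ln j u)) * iter_ln k u powr (- \<epsilon> - 1)" for u
  define F where "F u = iter_ln k u powr (- \<epsilon>)" for u
  obtain U where pos: "iter_ln j u > 0" if "u \<ge> U" "j \<le> k" for u j
    using eventually_iter_ln_pos[of k] by (auto simp: eventually_at_top_linorder)
  have F': "(F has_real_derivative - \<epsilon> * f u) (at u)" if "u \<ge> U" for u
  proof -
    have "iter_ln k u > 0" using pos that by simp
    moreover have "(iter_ln k has_real_derivative (\<Prod>j<k. inverse (iter_ln j u))) (at u)"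
      by (rule DERIV_iter_ln) (use pos that in auto)
    ultimately have "((\<lambda>u. iter_ln k u powr (- \<epsilon>)) has_real_derivative
        (- \<epsilon>) * iter_ln k u powr (- \<epsilon> - 1) * (\<Prod>j<k. inverse (iter_ln j u))) (at u)"
      using DERIV_chain2[OF has_real_derivative_powr] by fastforce
    then show ?thesis by (simp add: F_def[abs_def] f_def mult_ac)
  qed
  have anti: "f v \<le> f u" if "U \<le> u" "u \<le> v" for u v
    unfolding f_def
  proof (intro mult_mono prod_mono powr_mono2' conjI prod_nonneg)
    have "U \<le> v" using that by simp
    have le: "iter_ln j u \<le> iter_ln j v" if "j \<le> k" for j
      using \<open>U \<le> u\<close> \<open>u \<le> v\<close> that pos by (intro iter_ln_mono) auto
    show "iter_ln k u \<le> iter_ln k v" using le by simp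
    fix j assume j: "j \<in> {..<k}"
    show "inverse (iter_ln j v) \<le> inverse (iter_ln j u)"
      using le[of j] pos[OF \<open>U \<le> u\<close>, of j] j by simp
    show "0 \<le> inverse (iter_ln j v)" "0 \<le> inverse (iter_ln j u)"
      using pos[OF \<open>U \<le> u\<close>, of j] pos[OF \<open>U \<le> v\<close>, of j] j by simp_all
  qed (use assms pos[OF that(1), of k] in auto)
  obtain N where N: "U \<le> real l * a" if "l \<ge> N" for l
  proof
    fix l assume "l \<ge> nat \<lceil>U / a\<rceil>"
    then have "U / a \<le> real l" by linarith
    then show "U \<le> real l * a" using assms by (simp add: field_simps)
  qed
  have step: "norm (f (real (Suc l) * a)) \<le> (F (real l * a) - F (real (Suc l) * a)) / (\<epsilon> * a)" if lN: "l \<ge> N" for l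
  proof -
    have lt: "real l * a < real (Suc l) * a" using assms by simp
    obtain z where z: "real l * a < z" "z < real (Suc l) * a"
      "F (real (Suc l) * a) - F (real l * a) = (real (Suc l) * a - real l * a) * (- \<epsilon> * f z)"
      using MVT2[OF lt, of F "\<lambda>u. - \<epsilon> * f u"] F' N[OF lN] by (meson order_trans)
    have "f (real (Suc l) * a) \<le> f z" using z N[OF lN] by (intro anti) auto
    moreover have "F (real l * a) - F (real (Suc l) * a) = \<epsilon> * a * f z"
      using z(3) by (simp add: algebra_simps)
    moreover have "0 \<le> f (real (Suc l) * a)"
      using pos[of "real (Suc l) * a"] N[of "Suc l"] lN unfolding f_def
      by (intro mult_nonneg_nonneg prod_nonneg) (auto intro: less_imp_le)
    ultimately show ?thesis using assms by simp
  qed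
  have "filterlim (\<lambda>l. real l * a) at_top sequentially"
    using assms by (intro filterlim_at_top_mult_tendsto_pos[OF tendsto_const])
      (auto simp: filterlim_real_sequentially mult.commute)
  from filterlim_compose[OF filterlim_iter_ln_at_top this]
  have "(\<lambda>l. F (real l * a)) \<longlonglongrightarrow> 0"
    unfolding F_def using assms by (intro tendsto_neg_powr) auto
  from telescope_summable'[OF this]
  have "summable (\<lambda>l. (F (real l * a) - F (real (Suc l) * a)) / (\<epsilon> * a))"
    by (rule summable_divide)
  then have "summable (\<lambda>l. f (real (Suc l) * a))"
    by (rule summable_comparison_test'[of _ N]) (rule step)
  then have "summable (\<lambda>l. f (real l * a))" by (subst (asm) summable_Suc_iff)
  then show ?thesis by (simp add: f_def)
qed

text \<open>
  On the geometric sequence \<open>b ^ l\<close> the power in \<open>\<varpi>\<close> equals \<open>q ^ l\<close>, and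
  \<open>ln (b ^ l) = l * ln b\<close> lowers every iterated logarithm by one level.
\<close>

lemma summable_varpi:
  assumes "\<epsilon> > 0" "k \<ge> 1" "b > 1" "b powr \<alpha> = q"
    and T: "varpi_threshold \<alpha> k \<epsilon> (T \<alpha> k \<epsilon>)"
  shows "summable (\<lambda>l. varpi T k \<alpha> \<epsilon> (b ^ l) / q ^ l)"
proof -
  obtain K where k: "k = Suc K" using assms(2) by (cases k) auto
  define a where "a = ln b"
  have a: "a > 0" using assms by (simp add: a_def)
  obtain N where N: "b ^ N > T \<alpha> k \<epsilon>" using real_arch_pow[OF \<open>b > 1\<close>] by auto
  have "summable (\<lambda>l. (\<Prod>j<K. inverse (iter_ln j (real l * a))) * iter_ln K (real l * a) powr (- \<epsilon> - 1))"
    by (rule summable_iter_ln[OF a assms(1)])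
  moreover have "varpi T k \<alpha> \<epsilon> (b ^ l) / q ^ l =
      (\<Prod>j<K. inverse (iter_ln j (real l * a))) * iter_ln K (real l * a) powr (- \<epsilon> - 1)" if "l \<ge> N" for l
  proof -
    have ge: "b ^ l \<ge> T \<alpha> k \<epsilon>" using power_increasing[OF that, of b] N assms(3) by linarith
    have pos: "iter_ln j (b ^ l) > 0" if "j \<le> k" for j
      using T iter_ln_mono[OF _ ge, of j] that unfolding varpi_threshold_def
      by (metis le_trans less_le_trans less_imp_le)
    have ln: "iter_ln (Suc j) (b ^ l) = iter_ln j (real l * a)" for j
      using assms(3) by (simp add: funpow_Suc_right ln_realpow a_def del: funpow.simps)
    have q: "(b ^ l) powr \<alpha> = q ^ l"
    proof -
      have "(b ^ l) powr \<alpha> = (b powr real l) powr \<alpha>" using assms(3) by (simp add: powr_realpow)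
      also have "\<dots> = (b powr \<alpha>) powr real l" by (simp add: powr_powr mult.commute)
      also have "\<dots> = (b powr \<alpha>) ^ l" using assms(3) by (intro powr_realpow) simp
      finally show ?thesis by (simp only: assms(4))
    qed
    have "q > 0" using assms(3,4) by auto
    have "Lambda k (b ^ l) = (\<Prod>j<k. iter_ln (Suc j) (b ^ l))"
      unfolding Lambda_def by (rule prod.reindex_bij_witness[of _ Suc "\<lambda>j. j - 1"]) auto
    also have "\<dots> = (\<Prod>j<K. iter_ln j (real l * a)) * iter_ln K (real l * a)"
      unfolding k by (simp only: ln prod.lessThan_Suc)
    finally have L: "Lambda k (b ^ l) = (\<Prod>j<K. iter_ln j (real l * a)) * iter_ln K (real l * a)" .
    have inv: "(\<Prod>j<K. inverse (iter_ln j (real l * a))) = inverse (\<Prod>j<K. iter_ln j (real l * a))"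
      by (simp add: prod_inversef[symmetric])
    have "iter_ln K (real l * a) > 0" using pos[of k] unfolding k ln by simp
    then show ?thesis using ge \<open>q > 0\<close>
      unfolding varpi_def varpi_formula_def L q inv
      by (simp add: k ln powr_diff field_simps del: funpow.simps)
  qed
  ultimately show ?thesis
    using summable_cong[OF eventually_sequentiallyI] by (metis (no_types, lifting))
qed

section \<open>Digits of \<open>p\<close>-adic integers\<close>

definition digit :: "nat \<Rightarrow> (nat \<Rightarrow> nat) \<Rightarrow> nat \<Rightarrow> nat" where
  "digit p x l = x (Suc l) div p ^ l"

lemma padic_ints_Suc:
  assumes "x \<in> padic_ints p"
  shows "x (Suc l) = x l + digit p x l * p ^ l"
proof -
  have "x (Suc l) mod p ^ l = x l" using assms by (simp add: padic_ints_def)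
  then show ?thesis using mod_div_mult_eq[of "x (Suc l)" "p ^ l"] by (simp add: digit_def)
qed

lemma digit_less:
  assumes "x \<in> padic_ints p"
  shows "digit p x l < p"
  using padic_ints_lt[OF assms, of "Suc l"] by (simp add: digit_def less_mult_imp_div_less)

lemma digit_padic_of_digits:
  assumes "\<And>l. d l < p"
  shows "digit p (padic_of_digits p d) l = d l"
proof -
  have "padic_of_digits p d (Suc l) = padic_of_digits p d l + d l * p ^ l"
    by (simp add: padic_of_digits_def)
  moreover have "p > 0" using assms[of 0] by simp
  ultimately show ?thesis using padic_of_digits_lt[of d p l] assms by (simp add: digit_def)
qed

lemma padic_of_digits_digit:
  assumes "x \<in> padic_ints p"
  shows "padic_of_digits p (digit p x) = x"
proof
  show "padic_of_digits p (digit p x) k = x k" for k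
  proof (induction k)
    case 0
    then show ?case using padic_ints_lt[OF assms, of 0] by (simp add: padic_of_digits_def)
  next
    case (Suc k)
    then show ?case using padic_ints_Suc[OF assms, of k] by (simp add: padic_of_digits_def)
  qed
qed

text \<open>
  The hypothesis says that \<open>x l + a\<close> is again a residue modulo \<open>p ^ l\<close>. Putting the higher digits of
  \<open>x\<close> in front keeps the sum in range modulo every larger power, so no reduction ever takes place.
\<close>

lemma digit_add_no_carry:
  assumes x: "x \<in> padic_ints p" and a: "0 \<le> int (x l) + a" "int (x l) + a < int (p ^ l)" and "l \<le> k"
  shows "digit p (padic_add p (padic_of_int p a) x) k = digit p x k"
proof -
  have p: "p > 0" using digit_less[OF x, of 0] by (cases p) auto
  have add: "int (padic_add p (padic_of_int p a) x i) = (int (x i) + a) mod int (p ^ i)" for i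
    using p by (simp add: padic_add_def padic_of_int_def zmod_int mod_simps add.commute)
  have range: "0 \<le> int (x i) + a \<and> int (x i) + a < int (p ^ i)" if "l \<le> i" for i
    using that
  proof (induction i rule: dec_induct)
    case base
    then show ?case using a by simp
  next
    case (step i)
    have "int (x (Suc i)) + a = (int (x i) + a) + int (digit p x i * p ^ i)"
      using padic_ints_Suc[OF x, of i] by simp
    moreover have "int (digit p x i * p ^ i) \<le> int ((p - 1) * p ^ i)"
      using digit_less[OF x, of i] by (simp only: of_nat_le_iff) (intro mult_right_mono, auto)
    moreover have "int ((p - 1) * p ^ i) + int (p ^ i) = int (p ^ Suc i)"
      using p by (cases p) (auto simp: algebra_simps)
    ultimately show ?case using step.IH by linarith
  qed
  have "int (padic_add p (padic_of_int p a) x (Suc k)) = int (x (Suc k)) + a"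
    unfolding add using range[of "Suc k"] \<open>l \<le> k\<close> by (intro mod_pos_pos_trivial) auto
  also have "\<dots> = (int (x k) + a) + int (digit p x k) * int (p ^ k)"
    using padic_ints_Suc[OF x, of k] by simp
  finally have "int (padic_add p (padic_of_int p a) x (Suc k)) div int (p ^ k) = int (digit p x k)"
    using range[OF \<open>l \<le> k\<close>] p by (simp add: div_pos_pos_trivial)
  then show ?thesis unfolding digit_def[of p "padic_add p (padic_of_int p a) x"]
    by (metis of_nat_eq_iff zdiv_int)
qed

text \<open>
  From level \<open>l\<close> on, equal digits contribute equally to \<open>x\<close> and \<open>y\<close>, so the difference of the residues
  is constant there; below level \<open>l\<close> the residues are determined by those at level \<open>l\<close>.
\<close>

lemma padic_add_of_equal_high_digits:
  assumes x: "x \<in> padic_ints p" and y: "y \<in> padic_ints p"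
    and eq: "\<And>k. l \<le> k \<Longrightarrow> digit p x k = digit p y k"
  shows "y = padic_add p (padic_of_int p (int (y l) - int (x l))) x"
proof
  fix k
  have p: "p > 0" using digit_less[OF x, of 0] by (cases p) auto
  have diff: "int (y i) - int (x i) = int (y l) - int (x l)" if "l \<le> i" for i
    using that
  proof (induction i rule: dec_induct)
    case (step i)
    then show ?case using padic_ints_Suc[OF x, of i] padic_ints_Suc[OF y, of i] eq[of i] by simp
  qed simp
  have "(int (y l) - int (x l) + int (x k)) mod int (p ^ k) = int (y k)"
  proof (cases "l \<le> k")
    case True
    have "int (y l) - int (x l) + int (x k) = int (y k)" using diff[OF True] by simp
    then show ?thesis using padic_ints_lt[OF y, of k] by (simp only: flip: zmod_int) simp
  next
    case False
    then have "k \<le> l" by simp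
    then have "int (x l) mod int (p ^ k) = int (x k)" "int (y l) mod int (p ^ k) = int (y k)"
      by (simp_all only: padic_ints_mod[OF x] padic_ints_mod[OF y] flip: zmod_int)
    then have "(int (y l) - int (x l) + int (x k)) mod int (p ^ k) =
        (int (y l) - int (x l) + int (x l) mod int (p ^ k)) mod int (p ^ k)" by simp
    also have "\<dots> = (int (y l) - int (x l) + int (x l)) mod int (p ^ k)" by (rule mod_add_right_eq)
    also have "\<dots> = int (y k)" using \<open>int (y l) mod int (p ^ k) = int (y k)\<close> by simp
    finally show ?thesis .
  qed
  then have "int (padic_add p (padic_of_int p (int (y l) - int (x l))) x k) = int (y k)"
    using p by (simp add: padic_add_def padic_of_int_def zmod_int mod_simps)
  then show "y k = padic_add p (padic_of_int p (int (y l) - int (x l))) x k" by simp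
qed

section \<open>Interleaving digits\<close>

definition interleave :: "nat \<Rightarrow> nat \<Rightarrow> (nat \<Rightarrow> nat \<Rightarrow> nat) \<Rightarrow> nat \<Rightarrow> nat" where
  "interleave p d z q = digit p (z (q mod d)) (q div d)"

definition deinterleave :: "nat \<Rightarrow> nat \<Rightarrow> (nat \<Rightarrow> nat) \<Rightarrow> nat \<Rightarrow> nat \<Rightarrow> nat" where
  "deinterleave p d s = (\<lambda>i\<in>{..<d}. padic_of_digits p (\<lambda>l. s (l * d + i)))"

lemma interleave_less:
  assumes "d > 0" "z \<in> (\<Pi>\<^sub>E i\<in>{..<d}. padic_ints p)"
  shows "interleave p d z q < p"
  unfolding interleave_def using assms by (intro digit_less) (auto simp: PiE_iff)

lemma interleave_deinterleave:
  assumes "d > 0" "\<And>q. s q < p"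
  shows "interleave p d (deinterleave p d s) = s"
  using assms by (auto simp: interleave_def deinterleave_def digit_padic_of_digits)

lemma deinterleave_interleave:
  assumes "z \<in> (\<Pi>\<^sub>E i\<in>{..<d}. padic_ints p)"
  shows "deinterleave p d (interleave p d z) = z"
proof
  fix i
  show "deinterleave p d (interleave p d z) i = z i"
  proof (cases "i < d")
    case True
    then have "z i \<in> padic_ints p" using assms by (auto simp: PiE_iff)
    then show ?thesis using True
      by (simp add: deinterleave_def interleave_def padic_of_digits_digit[unfolded eta_contract_eq])
  next
    case False
    then show ?thesis using assms by (auto simp: deinterleave_def PiE_iff extensional_def)
  qed
qed

lemma deinterleave_closed:
  assumes "\<And>q. s q < p"
  shows "deinterleave p d s \<in> (\<Pi>\<^sub>E i\<in>{..<d}. padic_ints p)"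
  using padic_of_digits_closed[of "\<lambda>l. s (l * d + _)"] assms
  by (auto simp: deinterleave_def intro!: padic_of_digits_closed)

definition shuffle :: "nat \<Rightarrow> nat \<Rightarrow> nat \<Rightarrow> (nat \<Rightarrow> nat \<Rightarrow> nat) \<Rightarrow> nat \<Rightarrow> nat \<Rightarrow> nat" where
  "shuffle p n m z = deinterleave p m (interleave p n z)"

lemma shuffle_closed:
  assumes "n > 0" "z \<in> (\<Pi>\<^sub>E i\<in>{..<n}. padic_ints p)"
  shows "shuffle p n m z \<in> (\<Pi>\<^sub>E i\<in>{..<m}. padic_ints p)"
  unfolding shuffle_def using assms by (intro deinterleave_closed interleave_less)

lemma shuffle_shuffle:
  assumes "n > 0" "m > 0" "z \<in> (\<Pi>\<^sub>E i\<in>{..<n}. padic_ints p)"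
  shows "shuffle p m n (shuffle p n m z) = z"
  unfolding shuffle_def using assms
  by (simp add: interleave_deinterleave interleave_less deinterleave_interleave)

text \<open>
  The point of this condition is that adding \<open>g\<close> to \<open>z\<close> then leaves every digit of level at least
  \<open>l\<close> unchanged. It also excludes borrowing, since \<open>g\<close> may have negative entries.
\<close>

definition no_carry :: "nat \<Rightarrow> nat \<Rightarrow> (nat \<Rightarrow> int) \<Rightarrow> nat \<Rightarrow> (nat \<Rightarrow> nat \<Rightarrow> nat) \<Rightarrow> bool" where
  "no_carry p d g l z \<longleftrightarrow> (\<forall>i<d. 0 \<le> int (z i l) + g i \<and> int (z i l) + g i < int (p ^ l))"

text \<open>
  Below stream position \<open>l * n\<close> there are, in each of the \<open>m\<close> coordinates of the image, only digits of
  level less than \<open>L = l * n div m + 1\<close>. Each coordinate of \<open>h\<close> is the difference of two residues modulo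
  \<open>p ^ L\<close>.
\<close>

lemma shuffle_adding_machine:
  assumes p: "p > 0" and n: "n > 0" and m: "m > 0" and z: "z \<in> space (padic_space p n)"
    and g: "no_carry p n g l z"
  obtains h where "h \<in> carrier (Zpow m)"
    "shuffle p n m (adding_machine p n g z) = adding_machine p m h (shuffle p n m z)"
    "l1_length m h \<le> m * p ^ (l * n div m + 1)"
proof -
  let ?L = "l * n div m + 1"
  let ?w = "adding_machine p n g z"
  define x where "x = shuffle p n m z"
  define y where "y = shuffle p n m ?w"
  have zP: "z \<in> (\<Pi>\<^sub>E i\<in>{..<n}. padic_ints p)" using z p by (simp add: space_padic_space)
  have wP: "?w \<in> (\<Pi>\<^sub>E i\<in>{..<n}. padic_ints p)"
    using adding_machine_closed[OF p z] p by (simp add: space_padic_space)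
  have xP: "x \<in> (\<Pi>\<^sub>E i\<in>{..<m}. padic_ints p)" and yP: "y \<in> (\<Pi>\<^sub>E i\<in>{..<m}. padic_ints p)"
    unfolding x_def y_def by (rule shuffle_closed[OF n zP], rule shuffle_closed[OF n wP])
  have same: "interleave p n ?w q = interleave p n z q" if "l * n \<le> q" for q
  proof -
    have i: "q mod n < n" using n by simp
    have "l \<le> q div n" using that n by (simp add: less_eq_div_iff_mult_less_eq)
    then have "digit p (padic_add p (padic_of_int p (g (q mod n))) (z (q mod n))) (q div n)
        = digit p (z (q mod n)) (q div n)"
      using g i zP by (intro digit_add_no_carry) (auto simp: no_carry_def PiE_iff)
    then show ?thesis using i by (simp add: interleave_def adding_machine_apply[OF z])
  qed
  have high: "digit p (x i) k = digit p (y i) k" if "i < m" "?L \<le> k" for i k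
  proof -
    have "l * n < ?L * m"
      using m by (metis Suc_eq_plus1 dividend_less_times_div mult.commute mult_Suc_right)
    also have "\<dots> \<le> k * m" using that by (intro mult_right_mono) auto
    finally have "l * n \<le> k * m + i" by simp
    moreover have "digit p (x i) k = interleave p n z (k * m + i)"
      "digit p (y i) k = interleave p n ?w (k * m + i)"
      using that interleave_less[OF n zP] interleave_less[OF n wP]
      by (simp_all add: x_def y_def shuffle_def deinterleave_def digit_padic_of_digits)
    ultimately show ?thesis using same by simp
  qed
  define h where "h = (\<lambda>i\<in>{..<m}. int (y i ?L) - int (x i ?L))"
  have "y = adding_machine p m h x"
  proof
    fix i
    have "x \<in> space (padic_space p m)" using xP p by (simp add: space_padic_space)
    note * = adding_machine_apply[OF this, of h]
    show "y i = adding_machine p m h x i"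
    proof (cases "i < m")
      case True
      then have "y i = padic_add p (padic_of_int p (int (y i ?L) - int (x i ?L))) (x i)"
        using xP yP high by (intro padic_add_of_equal_high_digits) (auto simp: PiE_iff)
      then show ?thesis using True unfolding * by (simp add: h_def)
    next
      case False
      then show ?thesis using yP by (auto simp: * PiE_iff extensional_def simp del: One_nat_def)
    qed
  qed
  moreover have "h \<in> carrier (Zpow m)" by (simp add: h_def)
  moreover have "l1_length m h \<le> (\<Sum>i<m. p ^ ?L)"
    unfolding l1_length_def
  proof (rule sum_mono)
    fix i assume i: "i \<in> {..<m}"
    have "x i ?L < p ^ ?L" "y i ?L < p ^ ?L"
      using i xP yP by (auto simp: PiE_iff simp del: power_Suc intro!: padic_ints_lt)
    then show "nat \<bar>h i\<bar> \<le> p ^ ?L" using i by (simp add: h_def del: power_Suc)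
  qed
  ultimately show thesis using that unfolding x_def y_def by simp
qed

section \<open>The shuffle preserves Haar measure\<close>

abbreviation digit_measure :: "nat \<Rightarrow> (nat \<Rightarrow> nat) measure" where
  "digit_measure p \<equiv> Pi\<^sub>M UNIV (\<lambda>_. uniform_count_measure {..<p})"

lemma product_prob_space_digits:
  fixes p :: nat
  assumes "p > 0"
  shows "product_prob_space (\<lambda>_::nat. uniform_count_measure {..<p})"
proof -
  have "prob_space (uniform_count_measure {..<p})"
    using assms by (intro prob_space_uniform_count_measure) auto
  then show ?thesis
    by (simp add: product_prob_space_def product_prob_space_axioms_def
        product_sigma_finite_def prob_space_imp_sigma_finite)
qed

lemma digit_measure_less: "s \<in> space (digit_measure p) \<Longrightarrow> s q < p"
  by (auto simp: space_PiM PiE_iff space_uniform_count_measure)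

lemma measurable_digit_coord:
  assumes "q \<in> I"
  shows "(\<lambda>s. s q) \<in> measurable (Pi\<^sub>M I (\<lambda>_. uniform_count_measure A)) (count_space UNIV)"
  by (rule measurable_compose[OF measurable_component_singleton[OF assms]])
     (simp add: measurable_def sets_uniform_count_measure space_uniform_count_measure)

lemma measurable_padic_of_digits:
  assumes p: "p > 0" and d: "\<And>l s. s \<in> space M \<Longrightarrow> d s l < p"
    and meas: "\<And>l. (\<lambda>s. d s l) \<in> measurable M (count_space UNIV)"
  shows "(\<lambda>s. padic_of_digits p (d s)) \<in> measurable M (padic_haar p)"
proof -
  have "(\<lambda>s. padic_of_digits p (d s)) \<in> measurable M (restrict_space borel (padic_ints p))"
  proof (rule measurable_into_padic_ints)
    show "padic_of_digits p (d s) \<in> padic_ints p" if "s \<in> space M" for s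
      using padic_of_digits_closed d[OF that] by blast
    show "(\<lambda>s. padic_of_digits p (d s) k) \<in> measurable M (count_space UNIV)" for k
      unfolding padic_of_digits_def
    proof (induction k)
      case (Suc k)
      have "(\<lambda>s. (\<Sum>i<k. d s i * p ^ i) + b * p ^ k) \<in> measurable M (count_space UNIV)" for b
        by (rule measurable_compose[OF Suc]) simp
      from measurable_compose_countable[OF this meas[of k]] show ?case by simp
    qed simp
  qed
  then show ?thesis using measurable_cong_sets[OF refl sets_padic_haar[OF p]] by blast
qed

text \<open>
  A residue modulo \<open>p ^ k\<close> prescribes the \<open>k\<close> independent uniform digits at positions
  \<open>t 0, \<dots>, t (k - 1)\<close>, so its class has measure \<open>1 / p ^ k\<close>; this characterises Haar measure.
\<close>

lemma distr_padic_of_digits: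
  assumes p: "p > 0" and t: "inj t"
  shows "distr (digit_measure p) (padic_haar p) (\<lambda>s. padic_of_digits p (\<lambda>l. s (t l))) = padic_haar p"
proof -
  let ?U = "uniform_count_measure {..<p}"
  let ?P = "digit_measure p" and ?f = "\<lambda>s. padic_of_digits p (\<lambda>l. s (t l))"
  interpret product_prob_space "\<lambda>_. ?U" "UNIV :: nat set" by (rule product_prob_space_digits[OF p])
  have meas: "?f \<in> measurable ?P (padic_haar p)"
  proof (rule measurable_padic_of_digits[OF p])
    show "s (t l) < p" if "s \<in> space ?P" for l s using digit_measure_less[OF that] .
    show "(\<lambda>s. s (t l)) \<in> measurable ?P (count_space UNIV)" for l
      by (rule measurable_digit_coord) simp
  qed
  show ?thesis
  proof (rule padic_measure_eqI)
    show "prob_space (distr ?P (padic_haar p) ?f)"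
      using meas by (rule P.prob_space_distr)
    fix k a assume a: "a < p ^ k"
    have "emeasure (distr ?P (padic_haar p) ?f) (padic_cylinder p k a) =
        emeasure ?P (?f -` padic_cylinder p k a \<inter> space ?P)"
      using meas by (rule emeasure_distr) (rule padic_cylinder_sets[OF sets_padic_haar[OF p]])
    also have "?f -` padic_cylinder p k a \<inter> space ?P =
        {s \<in> space ?P. \<forall>q\<in>t ` {..<k}. s q \<in> {(a div p ^ the_inv t q) mod p}}"
    proof (rule Set.set_eqI)
      fix s
      show "s \<in> ?f -` padic_cylinder p k a \<inter> space ?P \<longleftrightarrow>
          s \<in> {s \<in> space ?P. \<forall>q\<in>t ` {..<k}. s q \<in> {(a div p ^ the_inv t q) mod p}}"
      proof (cases "s \<in> space ?P")
        case True
        then have "padic_of_digits p (\<lambda>l. s (t l)) k = a \<longleftrightarrow> (\<forall>i<k. s (t i) = (a div p ^ i) mod p)"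
          "?f s \<in> padic_ints p"
          by (intro padic_of_digits_eq_iff padic_of_digits_closed digit_measure_less a; simp)+
        then show ?thesis using True by (auto simp: padic_cylinder_def the_inv_f_f[OF t])
      qed simp
    qed
    also have "emeasure ?P \<dots> = (\<Prod>q\<in>t ` {..<k}. emeasure ?U {(a div p ^ the_inv t q) mod p})"
      by (rule emeasure_PiM_Collect) (use p in \<open>auto simp: sets_uniform_count_measure\<close>)
    also have "\<dots> = (\<Prod>q\<in>t ` {..<k}. ennreal (1 / real p))"
      using p by (intro prod.cong refl) (simp add: emeasure_uniform_count_measure)
    also have "\<dots> = ennreal (1 / real (p ^ k))"
      using inj_on_subset[OF t] by (simp add: card_image ennreal_power power_one_over)
    also have "\<dots> = emeasure (padic_haar p) (padic_cylinder p k a)"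
      by (rule padic_haar_measure_cylinder[OF p padic_haar_measure_padic_haar[OF p] a, symmetric])
    finally show "emeasure (distr ?P (padic_haar p) ?f) (padic_cylinder p k a) =
        emeasure (padic_haar p) (padic_cylinder p k a)" .
  qed (simp_all add: sets_padic_haar[OF p])
qed

text \<open>
  The coordinates of the result are functions of the digits in disjoint blocks of positions, the
  residue classes modulo \<open>d\<close>. They are therefore independent, and each is Haar distributed by
  \<open>distr_padic_of_digits\<close>.
\<close>

lemma distr_deinterleave:
  assumes p: "p > 0" and d: "d > 0"
  shows "deinterleave p d \<in> measurable (digit_measure p) (padic_space p d)"
    and "distr (digit_measure p) (padic_space p d) (deinterleave p d) = padic_space p d"
proof -
  let ?U = "uniform_count_measure {..<p}"
  let ?P = "digit_measure p" and ?f = "\<lambda>i s. padic_of_digits p (\<lambda>l. s (l * d + i))"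
  interpret product_prob_space "\<lambda>_. ?U" "UNIV :: nat set" by (rule product_prob_space_digits[OF p])
  define K where "K i = range (\<lambda>l. l * d + i)" for i
  have K: "l * d + i \<in> K i" for l i unfolding K_def by (rule rangeI)
  have coord: "P.indep_vars (\<lambda>_. ?U) (\<lambda>q s. s q) UNIV"
  proof (subst P.indep_vars_iff_distr_eq_PiM)
    show "distr ?P (Pi\<^sub>M UNIV (\<lambda>_. ?U)) (\<lambda>x. \<lambda>q\<in>UNIV. x q) =
        Pi\<^sub>M UNIV (\<lambda>q. distr ?P ?U (\<lambda>s. s q))"
      by (simp add: PiM_component restrict_UNIV cong: PiM_cong)
  qed auto
  have disj: "disjoint_family_on K {..<d}"
  proof (unfold disjoint_family_on_def, intro ballI impI)
    fix i j assume ij: "i \<in> {..<d}" "j \<in> {..<d}" "i \<noteq> j"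
    have res: "q mod d = i" if "q \<in> K i" "i < d" for q i using that by (auto simp: K_def)
    then show "K i \<inter> K j = {}" using res[of _ i] res[of _ j] ij by auto
  qed
  have meas: "?f i \<in> measurable (Pi\<^sub>M (K i) (\<lambda>_. ?U)) (padic_haar p)" for i
  proof (rule measurable_padic_of_digits[OF p])
    show "s (l * d + i) < p" if "s \<in> space (Pi\<^sub>M (K i) (\<lambda>_. ?U))" for l s
      using that K by (auto simp: space_PiM PiE_iff space_uniform_count_measure)
    show "(\<lambda>s. s (l * d + i)) \<in> measurable (Pi\<^sub>M (K i) (\<lambda>_. ?U)) (count_space UNIV)" for l
      by (rule measurable_digit_coord[OF K])
  qed
  have "P.indep_vars (\<lambda>i. Pi\<^sub>M (K i) (\<lambda>_. ?U)) (\<lambda>i s. restrict (\<lambda>q. s q) (K i)) {..<d}"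
    by (rule P.indep_vars_restrict[OF coord _ disj]) simp
  from P.indep_vars_compose2[OF this meas]
  have ind: "P.indep_vars (\<lambda>_. padic_haar p) ?f {..<d}"
    by (simp add: K)
  have rv: "?f i \<in> measurable ?P (padic_haar p)" if "i < d" for i
    using ind that by (auto simp: P.indep_vars_def)
  have de: "deinterleave p d = (\<lambda>s. \<lambda>i\<in>{..<d}. ?f i s)"
    by (simp add: deinterleave_def fun_eq_iff)
  show "deinterleave p d \<in> measurable ?P (padic_space p d)"
    unfolding de padic_space_def by (rule measurable_restrict) (use rv in simp)
  have "distr ?P (Pi\<^sub>M {..<d} (\<lambda>_. padic_haar p)) (\<lambda>s. \<lambda>i\<in>{..<d}. ?f i s) =
      Pi\<^sub>M {..<d} (\<lambda>i. distr ?P (padic_haar p) (?f i))"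
    by (rule P.indep_vars_iff_distr_eq_PiM'[THEN iffD1, OF _ _ ind]) (use d rv in auto)
  also have "\<dots> = Pi\<^sub>M {..<d} (\<lambda>i. padic_haar p)"
    using d by (intro PiM_cong refl distr_padic_of_digits[OF p]) (auto simp: inj_def)
  finally show "distr ?P (padic_space p d) (deinterleave p d) = padic_space p d"
    unfolding de padic_space_def .
qed

lemma measurable_interleave:
  assumes p: "p > 0" and d: "d > 0"
  shows "interleave p d \<in> measurable (padic_space p d) (digit_measure p)"
proof (rule measurable_PiM_single')
  show "interleave p d \<in> space (padic_space p d) \<rightarrow> (\<Pi>\<^sub>E i\<in>UNIV. space (uniform_count_measure {..<p}))"
    using p interleave_less[OF d]
    by (auto simp: space_padic_space space_uniform_count_measure)
  fix q :: nat
  have "(\<lambda>x. digit p x (q div d)) \<in> measurable (padic_haar p) (count_space UNIV)"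
  proof -
    have "(\<lambda>x. x (Suc (q div d))) \<in> measurable (padic_haar p) (count_space UNIV)"
      using padic_coord_measurable measurable_cong_sets[OF sets_padic_haar[OF p] refl] by blast
    then show ?thesis unfolding digit_def by (rule measurable_compose) simp
  qed
  then have "(\<lambda>z. interleave p d z q) \<in> measurable (padic_space p d) (count_space UNIV)"
    unfolding interleave_def padic_space_def using d
    by (intro measurable_compose[OF measurable_component_singleton]) auto
  then show "(\<lambda>z. interleave p d z q) \<in> measurable (padic_space p d) (uniform_count_measure {..<p})"
    using p interleave_less[OF d]
    by (auto simp: measurable_def space_padic_space space_uniform_count_measure sets_uniform_count_measure)
qed

text \<open>
  On digit streams the shuffle is the identity: both Haar measures are images of the same Bernoulli
  measure.
\<close>

lemma
  assumes p: "p > 0" and n: "n > 0" and m: "m > 0"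
  shows measurable_shuffle: "shuffle p n m \<in> measurable (padic_space p n) (padic_space p m)"
    and distr_shuffle: "distr (padic_space p n) (padic_space p m) (shuffle p n m) = padic_space p m"
proof -
  have sh: "shuffle p n m = (\<lambda>z. deinterleave p m (interleave p n z))"
    by (simp add: shuffle_def fun_eq_iff)
  show meas: "shuffle p n m \<in> measurable (padic_space p n) (padic_space p m)"
    unfolding sh by (rule measurable_compose[OF measurable_interleave[OF p n] distr_deinterleave(1)[OF p m]])
  have "distr (padic_space p n) (padic_space p m) (shuffle p n m) =
      distr (distr (digit_measure p) (padic_space p n) (deinterleave p n)) (padic_space p m) (shuffle p n m)"
    by (simp add: distr_deinterleave(2)[OF p n])
  also have "\<dots> = distr (digit_measure p) (padic_space p m) (shuffle p n m \<circ> deinterleave p n)"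
    by (rule distr_distr[OF meas distr_deinterleave(1)[OF p n]])
  also have "\<dots> = distr (digit_measure p) (padic_space p m) (deinterleave p m)"
    by (rule distr_cong) (simp_all add: shuffle_def interleave_deinterleave[OF n] digit_measure_less)
  also have "\<dots> = padic_space p m" by (rule distr_deinterleave(2)[OF p m])
  finally show "distr (padic_space p n) (padic_space p m) (shuffle p n m) = padic_space p m" .
qed

section \<open>Probability of long carries\<close>

text \<open>
  At most \<open>\<bar>a\<bar>\<close> residues, all near one end of \<open>{0..<p ^ l}\<close>, leave this interval when \<open>a\<close> is added,
  and each residue class has measure \<open>1 / p ^ l\<close>.
\<close>

lemma emeasure_padic_carry:
  assumes p: "p > 0"
  defines "B \<equiv> \<lambda>a l. {x \<in> padic_ints p. \<not> (0 \<le> int (x l) + a \<and> int (x l) + a < int (p ^ l))}"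
  shows "B a l \<in> sets (padic_haar p)"
    and "emeasure (padic_haar p) (B a l) \<le> ennreal (real (nat \<bar>a\<bar>) / real (p ^ l))"
proof -
  let ?R = "{r. r < p ^ l \<and> \<not> (0 \<le> int r + a \<and> int r + a < int (p ^ l))}"
  have B: "B a l = (\<Union>r\<in>?R. padic_cylinder p l r)"
    by (auto simp: B_def padic_cylinder_def dest: padic_ints_lt)
  have fin: "finite ?R" by simp
  have cyl: "padic_cylinder p l r \<in> sets (padic_haar p)" for r
    by (rule padic_cylinder_sets[OF sets_padic_haar[OF p]])
  show "B a l \<in> sets (padic_haar p)" unfolding B by (intro sets.finite_UN fin cyl)
  have "card ?R \<le> nat \<bar>a\<bar>"
  proof (cases "a \<ge> 0")
    case True
    then have "?R \<subseteq> {p ^ l - nat a..<p ^ l}" by (auto simp del: of_nat_power)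
    from card_mono[OF _ this] show ?thesis using True by simp
  next
    case False
    then have "?R \<subseteq> {..<nat (- a)}" by (auto simp del: of_nat_power)
    from card_mono[OF _ this] show ?thesis using False by simp
  qed
  then have le: "real (card ?R) \<le> real (nat \<bar>a\<bar>)" by simp
  have "emeasure (padic_haar p) (B a l) \<le> (\<Sum>r\<in>?R. emeasure (padic_haar p) (padic_cylinder p l r))"
    unfolding B by (rule emeasure_subadditive_finite[OF fin]) (use cyl in auto)
  also have "\<dots> = (\<Sum>r\<in>?R. ennreal (1 / real (p ^ l)))"
    by (intro sum.cong refl padic_haar_measure_cylinder[OF p padic_haar_measure_padic_haar[OF p]]) simp
  also have "\<dots> = ennreal (real (card ?R) / real (p ^ l))"
    by (simp add: ennreal_of_nat_eq_real_of_nat ennreal_mult[symmetric])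
  also have "\<dots> \<le> ennreal (real (nat \<bar>a\<bar>) / real (p ^ l))"
    using le by (intro ennreal_leI divide_right_mono) auto
  finally show "emeasure (padic_haar p) (B a l) \<le> ennreal (real (nat \<bar>a\<bar>) / real (p ^ l))" .
qed

lemma
  fixes d :: nat
  assumes p: "p > 0"
  defines "B \<equiv> \<lambda>g l. {z \<in> space (padic_space p d). \<not> no_carry p d g l z}"
  shows sets_carry: "B g l \<in> sets (padic_space p d)"
    and emeasure_carry: "emeasure (padic_space p d) (B g l) \<le> ennreal (real (l1_length d g) / real (p ^ l))"
proof -
  let ?H = "padic_haar p" and ?X = "padic_space p d"
  interpret H: prob_space ?H by (rule prob_space_padic_haar[OF p])
  interpret product_prob_space "\<lambda>_::nat. ?H" "{..<d}"
    by (simp add: product_prob_space_def product_prob_space_axioms_def product_sigma_finite_def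
        H.sigma_finite_measure_axioms H.prob_space_axioms)
  define C where "C a = {x \<in> padic_ints p. \<not> (0 \<le> int (x l) + a \<and> int (x l) + a < int (p ^ l))}" for a
  note C = emeasure_padic_carry[OF p, of l, folded C_def]
  have B: "B g l = (\<Union>i\<in>{..<d}. {z \<in> space ?X. z i \<in> C (g i)})"
    by (auto simp: B_def C_def no_carry_def space_padic_space[OF p] PiE_iff)
  have meas: "{z \<in> space ?X. z i \<in> C (g i)} \<in> sets ?X" if "i < d" for i
    unfolding padic_space_def using that C(1) by (intro measurable_sets_Collect[OF measurable_component_singleton]) auto
  show "B g l \<in> sets ?X" unfolding B by (intro sets.finite_UN meas) auto
  have "emeasure ?X (B g l) \<le> (\<Sum>i<d. emeasure ?X {z \<in> space ?X. z i \<in> C (g i)})"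
    unfolding B by (rule emeasure_subadditive_finite) (use meas in auto)
  also have "\<dots> = (\<Sum>i<d. emeasure ?H (C (g i)))"
    unfolding padic_space_def by (intro sum.cong refl emeasure_PiM_Collect_single C(1)) auto
  also have "\<dots> \<le> (\<Sum>i<d. ennreal (real (nat \<bar>g i\<bar>) / real (p ^ l)))"
    by (intro sum_mono C(2))
  also have "\<dots> = ennreal (real (l1_length d g) / real (p ^ l))"
    by (subst sum_ennreal) (simp_all add: l1_length_def sum_divide_distrib)
  finally show "emeasure ?X (B g l) \<le> ennreal (real (l1_length d g) / real (p ^ l))" .
qed

lemma AE_ex_no_carry:
  assumes p: "p \<ge> 2"
  shows "AE z in padic_space p d. \<exists>l. no_carry p d g l z"
proof (rule AE_I)
  let ?X = "padic_space p d"
  let ?B = "\<lambda>l. {z \<in> space ?X. \<not> no_carry p d g l z}"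
  have p0: "p > 0" using p by simp
  show "{z \<in> space ?X. \<not> (\<exists>l. no_carry p d g l z)} \<subseteq> (\<Inter>l. ?B l)" by auto
  show sets: "(\<Inter>l. ?B l) \<in> sets ?X" by (intro sets.countable_INT) (use sets_carry[OF p0] in auto)
  have "emeasure ?X (\<Inter>l. ?B l) \<le> ennreal (real (l1_length d g) / real (p ^ l))" for l
  proof -
    have "emeasure ?X (\<Inter>l. ?B l) \<le> emeasure ?X (?B l)"
      by (rule emeasure_mono[OF _ sets_carry[OF p0]]) auto
    then show ?thesis using emeasure_carry[OF p0] order_trans by blast
  qed
  moreover have "(\<lambda>l. ennreal (real (l1_length d g) / real (p ^ l))) \<longlonglongrightarrow> ennreal 0"
  proof (rule tendsto_ennrealI)
    have "(\<lambda>l. real (l1_length d g) * inverse (real p) ^ l) \<longlonglongrightarrow> 0"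
      using p by (intro tendsto_mult_right_zero LIMSEQ_realpow_zero) (auto simp: inverse_less_1_iff)
    then show "(\<lambda>l. real (l1_length d g) / real (p ^ l)) \<longlonglongrightarrow> 0"
      by (simp add: divide_inverse power_inverse)
  qed
  ultimately have "emeasure ?X (\<Inter>l. ?B l) \<le> ennreal 0"
    by (intro tendsto_lowerbound[where F = sequentially]) auto
  then show "emeasure ?X (\<Inter>l. ?B l) = 0" by simp
qed

lemma AE_all_ex_no_carry:
  assumes "p \<ge> 2"
  shows "AE z in padic_space p d. \<forall>g\<in>carrier (Zpow d). \<exists>l. no_carry p d g l z"
proof -
  have "countable (carrier (Zpow d))" by (simp add: countable_PiE)
  then show ?thesis by (subst AE_ball_countable) (use AE_ex_no_carry[OF assms] in auto)
qed

section \<open>The shuffle is an orbit equivalence\<close>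

text \<open>
  Freeness holds at every point here, so that the definite description in \<^const>\<open>cocycle\<close> has a unique
  solution as soon as it has one.
\<close>

lemma adding_machine_faithful:
  assumes p: "p \<ge> 2" and z: "z \<in> space (padic_space p d)"
    and gh: "g \<in> carrier (Zpow d)" "h \<in> carrier (Zpow d)"
    and eq: "adding_machine p d g z = adding_machine p d h z"
  shows "g = h"
proof -
  have p0: "p > 0" using p by simp
  have "g i = h i" if "i < d" for i
  proof -
    have zi: "z i \<in> padic_ints p" using z that p0 by (auto simp: space_padic_space PiE_iff)
    have "padic_add p (padic_of_int p (g i)) (z i) = padic_add p (padic_of_int p (h i)) (z i)"
      using fun_cong[OF eq, of i] that by (simp add: adding_machine_apply[OF z])
    then have "padic_add p (padic_of_int p (g i - h i)) (z i) = z i"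
      using padic_of_int_add[OF p0, of "- h i"] padic_add_of_int_0[OF zi]
      by (metis add.commute add.left_inverse uminus_add_conv_diff)
    from padic_add_of_int_fixed[OF p zi this] show ?thesis by simp
  qed
  then show ?thesis using gh by (intro PiE_ext[of g "{..<d}" "\<lambda>_. UNIV"]) auto
qed

lemma shuffle_orbit_subset:
  assumes p: "p > 0" and n: "n > 0" and m: "m > 0" and z: "z \<in> space (padic_space p n)"
    and "\<forall>g\<in>carrier (Zpow n). \<exists>l. no_carry p n g l z"
  shows "shuffle p n m ` orbit (Zpow n) (adding_machine p n) z \<subseteq>
    orbit (Zpow m) (adding_machine p m) (shuffle p n m z)"
proof
  fix y assume "y \<in> shuffle p n m ` orbit (Zpow n) (adding_machine p n) z"
  then obtain g where g: "g \<in> carrier (Zpow n)" and y: "y = shuffle p n m (adding_machine p n g z)"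
    by (auto simp: orbit_def)
  obtain l where "no_carry p n g l z" using assms(5) g by auto
  from shuffle_adding_machine[OF p n m z this] show "y \<in> orbit (Zpow m) (adding_machine p m) (shuffle p n m z)"
    unfolding y orbit_def by blast
qed

lemma ae_inverse_shuffle:
  assumes p: "p > 0" and n: "n > 0" and m: "m > 0"
  shows "ae_inverse (padic_space p n) (padic_space p m) (shuffle p n m) (shuffle p m n)"
  unfolding ae_inverse_def
  using measurable_shuffle[OF p m n] shuffle_shuffle[OF n m] shuffle_shuffle[OF m n]
  by (auto simp: space_padic_space[OF p])

text \<open>
  At a point where all carries stop, the shuffle maps the orbit into the orbit of the image. The
  same holds for the inverse shuffle at almost every image point, because the shuffle preserves measure,
  and the two inclusions give equality.
\<close>

lemma orbit_equivalence_shuffle: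
  assumes prime: "prime p" and n: "n > 0" and m: "m > 0"
  shows "orbit_equivalence (Zpow n) (padic_space p n) (adding_machine p n)
    (Zpow m) (padic_space p m) (adding_machine p m) (shuffle p n m)"
proof -
  have p: "p \<ge> 2" "p > 0" using prime prime_ge_2_nat prime_gt_0_nat by auto
  let ?X = "padic_space p n" and ?Y = "padic_space p m" and ?\<Phi> = "shuffle p n m"
  have iso: "measure_isomorphism ?X ?Y ?\<Phi>"
    unfolding measure_isomorphism_def
    using measurable_shuffle[OF p(2) n m] distr_shuffle[OF p(2) n m] ae_inverse_shuffle[OF p(2) n m] by blast
  have "AE y in distr ?X ?Y ?\<Phi>. \<forall>h\<in>carrier (Zpow m). \<exists>l. no_carry p m h l y"
    unfolding distr_shuffle[OF p(2) n m] by (rule AE_all_ex_no_carry[OF p(1)])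
  from AE_distrD[OF measurable_shuffle[OF p(2) n m] this]
  have "AE z in ?X. \<forall>h\<in>carrier (Zpow m). \<exists>l. no_carry p m h l (?\<Phi> z)" .
  with AE_all_ex_no_carry[OF p(1), of n] AE_space
  have "AE z in ?X. ?\<Phi> ` orbit (Zpow n) (adding_machine p n) z =
      orbit (Zpow m) (adding_machine p m) (?\<Phi> z)"
  proof eventually_elim
    case (elim z)
    let ?O = "orbit (Zpow m) (adding_machine p m) (?\<Phi> z)"
    have imz: "?\<Phi> z \<in> space ?Y" using measurable_space[OF measurable_shuffle[OF p(2) n m] elim(2)] .
    have recover: "shuffle p m n (?\<Phi> z) = z"
      using shuffle_shuffle[OF n m] elim(2) by (simp add: space_padic_space[OF p(2)])
    have "?O = ?\<Phi> ` shuffle p m n ` ?O"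
    proof -
      have "?O \<subseteq> space ?Y"
        using adding_machine_closed[OF p(2) imz] by (auto simp: orbit_def)
      then have "?\<Phi> (shuffle p m n y) = y" if "y \<in> ?O" for y
        using that shuffle_shuffle[OF m n] by (auto simp: space_padic_space[OF p(2)])
      then show ?thesis by (simp add: image_image)
    qed
    also have "\<dots> \<subseteq> ?\<Phi> ` orbit (Zpow n) (adding_machine p n) z"
      using shuffle_orbit_subset[OF p(2) m n imz elim(3)] unfolding recover by (rule image_mono)
    finally show ?case using shuffle_orbit_subset[OF p(2) n m elim(2,1)] by blast
  qed
  then show ?thesis
    using iso free_pmp_action_adding_machine[OF prime] unfolding orbit_equivalence_def by blast
qed

section \<open>Integrability of the cocycle\<close>

text \<open>
  The divisor \<open>m * p\<close> absorbs the number of coordinates and the rounding of \<open>l * n / m\<close> up to an integer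
  level, so that it depends neither on \<open>g\<close> nor on \<open>l\<close>.
\<close>

lemma cocycle_shuffle_le:
  assumes p: "p \<ge> 2" and n: "n > 0" and m: "m > 0" and z: "z \<in> space (padic_space p n)"
    and g: "no_carry p n g l z"
  shows "real (l1_length m (cocycle (adding_machine p n) (Zpow m) (adding_machine p m) (shuffle p n m) g z))
      / (real m * real p) \<le> (real p powr (real n / real m)) ^ l"
proof -
  have p0: "p > 0" using p by simp
  obtain h where h: "h \<in> carrier (Zpow m)"
    "shuffle p n m (adding_machine p n g z) = adding_machine p m h (shuffle p n m z)"
    "l1_length m h \<le> m * p ^ (l * n div m + 1)"
    by (rule shuffle_adding_machine[OF p0 n m z g])
  have imz: "shuffle p n m z \<in> space (padic_space p m)"
    using measurable_space[OF measurable_shuffle[OF p0 n m] z] .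
  have "cocycle (adding_machine p n) (Zpow m) (adding_machine p m) (shuffle p n m) g z = h"
    unfolding cocycle_def
  proof (rule the_equality)
    fix h' assume "h' \<in> carrier (Zpow m) \<and>
      shuffle p n m (adding_machine p n g z) = adding_machine p m h' (shuffle p n m z)"
    then show "h' = h" using h by (intro adding_machine_faithful[OF p imz]) auto
  qed (use h in blast)
  moreover have "real (l1_length m h) / (real m * real p) \<le> real p ^ (l * n div m)"
  proof -
    have "real (l1_length m h) \<le> real (m * p ^ (l * n div m + 1))" using h(3) by (simp only: of_nat_le_iff)
    then show ?thesis using m p by (simp add: field_simps)
  qed
  moreover have "real p ^ (l * n div m) \<le> (real p powr (real n / real m)) ^ l"
  proof -
    have "real p ^ (l * n div m) = real p powr real (l * n div m)" using p0 by (simp add: powr_realpow)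
    also have "\<dots> \<le> real p powr (real (l * n) / real m)"
      using p by (intro powr_mono of_nat_div_le_of_nat) auto
    also have "real (l * n) / real m = real n / real m * real l" by simp
    also have "real p powr \<dots> = (real p powr (real n / real m)) ^ l"
      using p0 by (simp only: powr_powr[symmetric]) (simp add: powr_realpow)
    finally show ?thesis .
  qed
  ultimately show ?thesis by simp
qed

text \<open>
  Let \<open>l\<close> be the least level that no carry reaches. Then the rescaled cocycle is at most \<open>b ^ l\<close>, and
  if \<open>l > 0\<close> a carry reaches level \<open>l - 1\<close>, an event whose probability is of order \<open>p ^ - l\<close>.
\<close>

lemma omega_integrable_shuffle:
  assumes p: "p \<ge> 2" and n: "n > 0" and m: "m > 0" and "mono \<omega>" and nonneg: "\<And>t. \<omega> t \<ge> 0"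
    and sum: "summable (\<lambda>l. \<omega> ((real p powr (real n / real m)) ^ l) / real p ^ l)"
  shows "omega_integrable \<omega> (Zpow n) (padic_space p n) (adding_machine p n)
    (Zpow m) (adding_machine p m) (l1_length m) (shuffle p n m)"
  unfolding omega_integrable_def
proof (intro ballI exI conjI)
  show "real m * real p > 0" using m p by simp
  fix g
  have p0: "p > 0" using p by simp
  let ?X = "padic_space p n"
  interpret X: prob_space ?X by (rule prob_space_padic_space[OF p0])
  let ?\<kappa> = "cocycle (adding_machine p n) (Zpow m) (adding_machine p m) (shuffle p n m) g"
  define b where "b = real p powr (real n / real m)"
  \<comment> \<open>Event \<open>A l\<close> contains the points whose least carry-free level is \<open>l\<close>; for \<open>l = 0\<close> there is no
    lower level to fail, so the whole space is taken.\<close>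
  define A where "A l = (case l of 0 \<Rightarrow> space ?X | Suc l' \<Rightarrow> {z \<in> space ?X. \<not> no_carry p n g l' z})" for l
  \<comment> \<open>The summand \<open>1\<close> covers \<open>A 0\<close>, the factor \<open>p\<close> the shift from \<open>l\<close> to \<open>l - 1\<close>.\<close>
  define C where "C = (1 + real (l1_length n g)) * real p"
  have A: "A l \<in> sets ?X" for l using sets_carry[OF p0] by (auto simp: A_def split: nat.split)
  have A_le: "emeasure ?X (A l) \<le> ennreal (C / real p ^ l)" for l
  proof (cases l)
    case 0
    have "1 * 1 \<le> C" unfolding C_def using p by (intro mult_mono) auto
    then have "ennreal 1 \<le> ennreal C" by (intro ennreal_leI) simp
    then show ?thesis using 0 by (simp add: A_def X.emeasure_space_1)
  next
    case (Suc l')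
    have "emeasure ?X (A l) \<le> ennreal (real (l1_length n g) / real (p ^ l'))"
      using emeasure_carry[OF p0] by (simp add: A_def Suc)
    also have "\<dots> \<le> ennreal (C / real p ^ l)"
      using p0 by (intro ennreal_leI) (simp add: C_def Suc field_simps)
    finally show ?thesis .
  qed
  have "(\<integral>\<^sup>+ z. ennreal (\<omega> (real (l1_length m (?\<kappa> z)) / (real m * real p))) \<partial>?X)
      \<le> (\<integral>\<^sup>+ z. (\<Sum>l. ennreal (\<omega> (b ^ l)) * indicator (A l) z) \<partial>?X)"
  proof (rule nn_integral_mono_AE)
    show "AE z in ?X. ennreal (\<omega> (real (l1_length m (?\<kappa> z)) / (real m * real p)))
        \<le> (\<Sum>l. ennreal (\<omega> (b ^ l)) * indicator (A l) z)"
      using AE_ex_no_carry[OF p, of n g] AE_space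
    proof eventually_elim
      case (elim z)
      define l where "l = (LEAST l. no_carry p n g l z)"
      have l: "no_carry p n g l z" using elim(1) unfolding l_def by (rule LeastI_ex)
      have "z \<in> A l"
        using elim(2) not_less_Least[of _ "\<lambda>l. no_carry p n g l z"]
        by (auto simp: A_def l_def[symmetric] split: nat.split)
      have "ennreal (\<omega> (real (l1_length m (?\<kappa> z)) / (real m * real p))) \<le> ennreal (\<omega> (b ^ l))"
        using monoD[OF \<open>mono \<omega>\<close> cocycle_shuffle_le[OF p n m elim(2) l]]
        unfolding b_def by (rule ennreal_leI)
      also have "\<dots> = (\<Sum>l\<in>{l}. ennreal (\<omega> (b ^ l)) * indicator (A l) z)" using \<open>z \<in> A l\<close> by simp
      also have "\<dots> \<le> (\<Sum>l. ennreal (\<omega> (b ^ l)) * indicator (A l) z)"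
        by (rule sum_le_suminf) auto
      finally show ?case .
    qed
  qed
  also have "\<dots> = (\<Sum>l. \<integral>\<^sup>+ z. ennreal (\<omega> (b ^ l)) * indicator (A l) z \<partial>?X)"
    using A by (intro nn_integral_suminf) auto
  also have "\<dots> = (\<Sum>l. ennreal (\<omega> (b ^ l)) * emeasure ?X (A l))"
    using A by (simp add: nn_integral_cmult_indicator)
  also have "\<dots> \<le> (\<Sum>l. ennreal (\<omega> (b ^ l) / real p ^ l * C))"
  proof (intro suminf_le allI)
    fix l
    have "ennreal (\<omega> (b ^ l)) * emeasure ?X (A l) \<le> ennreal (\<omega> (b ^ l)) * ennreal (C / real p ^ l)"
      by (intro mult_left_mono A_le) simp
    then show "ennreal (\<omega> (b ^ l)) * emeasure ?X (A l) \<le> ennreal (\<omega> (b ^ l) / real p ^ l * C)"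
      using nonneg by (simp add: ennreal_mult'[symmetric])
  qed auto
  also have "\<dots> = ennreal (\<Sum>l. \<omega> (b ^ l) / real p ^ l * C)"
    using sum nonneg unfolding b_def
    by (intro suminf_ennreal2 summable_mult2) (auto simp: C_def)
  also have "\<dots> < \<infinity>" by simp
  finally show "(\<integral>\<^sup>+ z. ennreal (\<omega> (real (l1_length m (?\<kappa> z)) / (real m * real p))) \<partial>?X) < \<infinity>" .
qed

text \<open>
  With \<open>b = p powr (n / m)\<close> the exponent \<open>m / n\<close> is the one for which \<open>b powr (m / n) = p\<close>, the critical
  growth against carry probabilities of order \<open>p ^ - l\<close>.
\<close>

lemma omega_integrable_varpi_shuffle:
  assumes p: "p \<ge> 2" and n: "n > 0" and m: "m > 0" and "\<epsilon> > 0" "k \<ge> 1"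
    and T: "varpi_threshold (real m / real n) k \<epsilon> (T (real m / real n) k \<epsilon>)"
  shows "omega_integrable (varpi T k (real m / real n) \<epsilon>)
    (Zpow n) (padic_space p n) (adding_machine p n)
    (Zpow m) (adding_machine p m) (l1_length m) (shuffle p n m)"
proof (rule omega_integrable_shuffle[OF p n m mono_varpi[of "real m / real n" k \<epsilon> T, OF T]])
  show "varpi T k (real m / real n) \<epsilon> t \<ge> 0" for t
    using varpi_pos[of "real m / real n" k \<epsilon> T t, OF T] by simp
  have "real p powr (real n / real m) > 1" using p n m by simp
  moreover have "(real p powr (real n / real m)) powr (real m / real n) = real p"
    using p n m by (simp add: powr_powr)
  ultimately show "summable (\<lambda>l. varpi T k (real m / real n) \<epsilon> ((real p powr (real n / real m)) ^ l) / real p ^ l)"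
    by (rule summable_varpi[where T = T, OF \<open>\<epsilon> > 0\<close> \<open>k \<ge> 1\<close> _ _ T])
qed

theorem theorem1p6:
  fixes n m p :: nat and T :: "real \<Rightarrow> nat \<Rightarrow> real \<Rightarrow> real"
  assumes "n > 0" and "m > 0" and "prime p"
    and T: "\<And>\<alpha> k \<epsilon>. \<alpha> > 0 \<Longrightarrow> k \<ge> 1 \<Longrightarrow> \<epsilon> > 0 \<Longrightarrow> varpi_threshold \<alpha> k \<epsilon> (T \<alpha> k \<epsilon>)"
  shows "\<exists>\<Phi>.
    orbit_equivalence
      (Zpow n) (padic_space p n) (adding_machine p n)
      (Zpow m) (padic_space p m) (adding_machine p m) \<Phi> \<and>
    (\<forall>\<epsilon>>0. \<forall>k\<ge>1.
      omega_pair_integrable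
        (varpi T k (real m / real n) \<epsilon>) (varpi T k (real n / real m) \<epsilon>)
        (Zpow n) (padic_space p n) (adding_machine p n) (l1_length n)
        (Zpow m) (padic_space p m) (adding_machine p m) (l1_length m) \<Phi>)"
proof (intro exI[of _ "shuffle p n m"] conjI allI impI)
  show "orbit_equivalence (Zpow n) (padic_space p n) (adding_machine p n)
      (Zpow m) (padic_space p m) (adding_machine p m) (shuffle p n m)"
    by (rule orbit_equivalence_shuffle[OF assms(3,1,2)])
  have p: "p \<ge> 2" using assms(3) by (rule prime_ge_2_nat)
  fix \<epsilon> :: real and k :: nat assume "\<epsilon> > 0" "k \<ge> 1"
  then show "omega_pair_integrable (varpi T k (real m / real n) \<epsilon>) (varpi T k (real n / real m) \<epsilon>)
      (Zpow n) (padic_space p n) (adding_machine p n) (l1_length n)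
      (Zpow m) (padic_space p m) (adding_machine p m) (l1_length m) (shuffle p n m)"
    unfolding omega_pair_integrable_def
    using assms p ae_inverse_shuffle[of p n m]
    by (intro conjI exI[of _ "shuffle p m n"] omega_integrable_varpi_shuffle T) auto
qed

end
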